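(* Let $k \in \mathbb{Z}$, $k \ge 2$. There is an algorithm that decides whether or not a given matrix $M \in SL_2(\mathbb{Z})$ is in the subgroup of $SL_2(\mathbb{Z})$ generated by $A(k)$ and $B(k)$ (and, if it is, finds a presentation of $M$ as a group word in $A(k)$ and $B(k)$) in time $O(n \cdot \log n)$, where $n = |M|$.
   Context: Notation: $A(k) = \begin{pmatrix} 1 & k \\ 0 & 1 \end{pmatrix}$ and $B(k) = \begin{pmatrix} 1 & 0 \\ k & 1 \end{pmatrix}$. The complexity $|M|$ of a matrix $M = \begin{pmatrix} m_{11} & m_{12} \\ m_{21} & m_{22} \end{pmatrix}$ is $|M| = \sum_{i,j} |m_{ij}|$. The integer $k$ is fixed and the input is $M$. Time is counted in bit operations with integers given by their digits, so that one addition of integers of absolute value at most $m$ takes time $O(\log m)$. *)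

theory Defs
  imports
    "HOL-Analysis.Determinants"
    "HOL-Algebra.Generated_Groups"
    "HOL-Library.Landau_Symbols"
begin

section \<open>The group and its two generators\<close>

definition SL2Z :: "(int^2^2) monoid" where
  "SL2Z = \<lparr>carrier = {M. det M = 1}, monoid.mult = (**), one = mat 1\<rparr>"

definition matA :: "int \<Rightarrow> int^2^2" where
  "matA k = vector [vector [1, k], vector [0, 1]]"

definition matB :: "int \<Rightarrow> int^2^2" where
  "matB k = vector [vector [1, 0], vector [k, 1]]"

definition complexity :: "int^2^2 \<Rightarrow> nat" where
  "complexity M = nat (\<Sum>i\<in>UNIV. \<Sum>j\<in>UNIV. \<bar>M $ i $ j\<bar>)"

lemma group_SL2Z: "group SL2Z"
proof (rule groupI)
  fix M :: "int^2^2" assume M: "M \<in> carrier SL2Z"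
  define N :: "int^2^2" where
    "N = vector [vector [M$2$2, - M$1$2], vector [- M$2$1, M$1$1]]"
  have "det N = 1" "N ** M = mat 1"
    using M by (simp_all add: SL2Z_def N_def det_2 vec_eq_iff forall_2 sum_2
      matrix_matrix_mult_def mat_def algebra_simps)
  then show "\<exists>y\<in>carrier SL2Z. y \<otimes>\<^bsub>SL2Z\<^esub> M = \<one>\<^bsub>SL2Z\<^esub>"
    by (auto simp: SL2Z_def)
qed (simp_all add: SL2Z_def det_mul matrix_mul_assoc)

lemma matA_in_SL2Z: "matA k \<in> carrier SL2Z"
  and matB_in_SL2Z: "matB k \<in> carrier SL2Z"
  by (simp_all add: SL2Z_def matA_def matB_def det_2)


section \<open>Group words\<close>

datatype generator = GenA | GenB

text \<open>A letter is a generator together with a flag that is true for its inverse.\<close>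

type_synonym letter = "generator \<times> bool"

fun letter_val :: "int \<Rightarrow> letter \<Rightarrow> int^2^2" where
  "letter_val k (g, neg) =
     (let X = (case g of GenA \<Rightarrow> matA k | GenB \<Rightarrow> matB k)
      in if neg then inv\<^bsub>SL2Z\<^esub> X else X)"

definition word_val :: "int \<Rightarrow> letter list \<Rightarrow> int^2^2" where
  "word_val k w = foldr (\<lambda>l N. letter_val k l \<otimes>\<^bsub>SL2Z\<^esub> N) w \<one>\<^bsub>SL2Z\<^esub>"


section \<open>Bit-level computations and their running time\<close>

text \<open>
  The model of computation: structured programs on finitely many stacks of bits. Every elementary
  instruction and every test inspects or changes a single bit and takes one unit of time. Integers
  are not primitive, so the cost of integer arithmetic is the number of bit operations needed to
  carry it out. A tape of a Turing machine is a pair of stacks, and control flow here is a finite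
  control, so running times agree with those of deterministic multitape Turing machines up to a
  constant factor depending only on the program.
\<close>

datatype test =
    Nonempty nat
  | Top nat

datatype program =
    Skip
  | Push nat bool
  | Pop nat
  | Seq program program
  | Cond test program program
  | While test program

type_synonym store = "nat \<Rightarrow> bool list"

fun holds :: "test \<Rightarrow> store \<Rightarrow> bool" where
  "holds (Nonempty x) s = (s x \<noteq> [])"
| "holds (Top x) s = (s x \<noteq> [] \<and> hd (s x))"

text \<open>\<open>exec p s t s'\<close>: started in \<open>s\<close>, the program \<open>p\<close> halts in \<open>s'\<close> after exactly
  \<open>t\<close> bit operations. Popping an empty stack leaves it empty.\<close>

inductive exec :: "program \<Rightarrow> store \<Rightarrow> nat \<Rightarrow> store \<Rightarrow> bool" where
  Skip: "exec Skip s 1 s"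
| Push: "exec (Push x b) s 1 (s(x := b # s x))"
| Pop: "exec (Pop x) s 1 (s(x := tl (s x)))"
| Seq: "exec p s t s' \<Longrightarrow> exec q s' u s'' \<Longrightarrow> exec (Seq p q) s (t + u) s''"
| CondTrue: "holds e s \<Longrightarrow> exec p s t s' \<Longrightarrow> exec (Cond e p q) s (1 + t) s'"
| CondFalse: "\<not> holds e s \<Longrightarrow> exec q s t s' \<Longrightarrow> exec (Cond e p q) s (1 + t) s'"
| WhileFalse: "\<not> holds e s \<Longrightarrow> exec (While e p) s 1 s"
| WhileTrue: "holds e s \<Longrightarrow> exec p s t s' \<Longrightarrow> exec (While e p) s' u s'' \<Longrightarrow>
    exec (While e p) s (1 + t + u) s''"

inductive_cases execE:
  "exec Skip s t s'"
  "exec (Push x b) s t s'"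
  "exec (Pop x) s t s'"
  "exec (Seq p q) s t s'"
  "exec (Cond e p q) s t s'"
  "exec (While e p) s t s'"

lemma exec_deterministic:
  "exec p s t s' \<Longrightarrow> exec p s u s'' \<Longrightarrow> t = u \<and> s' = s''"
proof (induction arbitrary: u s'' rule: exec.induct)
  case (Skip s)
  from this show ?case by (rule execE(1)) simp
next
  case (Push x b s)
  from this show ?case by (rule execE(2)) simp
next
  case (Pop x s)
  from this show ?case by (rule execE(3)) simp
next
  case (Seq p s t s1 q v s2)
  from Seq.prems obtain t' v' s1' where
    "exec p s t' s1'" "exec q s1' v' s''" "u = t' + v'"
    by (rule execE(4))
  note r = this
  have "t = t'" "s1' = s1" using Seq.IH(1)[OF r(1)] by blast+
  moreover have "v = v'" "s2 = s''" using Seq.IH(2) r(2) \<open>s1' = s1\<close> by blast+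
  ultimately show ?case using r(3) by simp
next
  case (CondTrue e s p t s1 q)
  from CondTrue.prems obtain t' where "exec p s t' s''" "u = Suc t'"
    by (rule execE(5)) (use CondTrue.hyps(1) in blast)+
  note r = this
  show ?case using CondTrue.IH[OF r(1)] r(2) by simp
next
  case (CondFalse e s q t s1 p)
  from CondFalse.prems obtain t' where "exec q s t' s''" "u = Suc t'"
    by (rule execE(5)) (use CondFalse.hyps(1) in blast)+
  note r = this
  show ?case using CondFalse.IH[OF r(1)] r(2) by simp
next
  case (WhileFalse e s p)
  from WhileFalse.prems show ?case
    by (rule execE(6)) (use WhileFalse.hyps(1) in simp_all)
next
  case (WhileTrue e s p t s1 v s2)
  from WhileTrue.prems obtain t' v' s1' where
    "exec p s t' s1'" "exec (While e p) s1' v' s''" "u = Suc (t' + v')"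
    by (rule execE(6)) (use WhileTrue.hyps(1) in blast)+
  note r = this
  have "t = t'" "s1' = s1" using WhileTrue.IH(1)[OF r(1)] by blast+
  moreover have "v = v'" "s2 = s''" using WhileTrue.IH(2) r(2) \<open>s1' = s1\<close> by blast+
  ultimately show ?case using r(3) by simp
qed


section \<open>Encoding of inputs and outputs\<close>

text \<open>Least significant digit first, without leading zeros.\<close>

fun nat_digits :: "nat \<Rightarrow> bool list" where
  "nat_digits n = (if n = 0 then [] else odd n # nat_digits (n div 2))"

declare nat_digits.simps [simp del]

definition int_digits :: "int \<Rightarrow> bool list" where
  "int_digits z = (z < 0) # nat_digits (nat \<bar>z\<bar>)"

definition input_store :: "int^2^2 \<Rightarrow> store" where
  "input_store M = (\<lambda>_. [])
     (0 := int_digits (M $ 1 $ 1), 1 := int_digits (M $ 1 $ 2),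
      2 := int_digits (M $ 2 $ 1), 3 := int_digits (M $ 2 $ 2))"

text \<open>Two bits per letter; the first letter of the word is on top of the stack.\<close>

definition word_bits :: "letter list \<Rightarrow> bool list" where
  "word_bits w = concat (map (\<lambda>(g, neg). [g = GenB, neg]) w)"

text \<open>The answer to the decision problem is returned on stack 4, the word on stack 5.\<close>

definition answer :: "store \<Rightarrow> bool list" where
  "answer s = s 4"

definition word_output :: "store \<Rightarrow> bool list" where
  "word_output s = s 5"

end

theory Submission
  imports
    Defs
    "HOL-Real_Asymp.Real_Asymp"
begin

text \<open>
  Greedy descent: multiply \<open>M\<close> on the right by \<open>A(k)\<close>, \<open>B(k)\<close> or an inverse as long as this
  lowers the complexity. By a ping-pong argument, a reduced word ending in a power of \<open>A(k)\<close>
  (respectively \<open>B(k)\<close>) has a strictly dominating second (first) column, entry by entry; as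
  \<open>k \<ge> 2\<close>, cancelling the last letter of a reduced word then lowers the complexity. Hence the
  descent ends in the identity exactly if \<open>M\<close> lies in the subgroup, and the inverses of the
  letters used spell \<open>M\<close>. There are at most \<open>|M|\<close> descent steps, and all numbers stay below
  \<open>(k + 1) |M|\<close>, so that each step takes \<open>O(log |M|)\<close> bit operations in fixed-width two's
  complement arithmetic.
\<close>

section \<open>Descent in the subgroup\<close>

text \<open>Little is lost: \<open>A(k)^e\<close> has complexity \<open>2 + k |e|\<close> and a word
  of \<open>|e|\<close> letters, so writing the word can by itself take a number of steps linear in
  \<open>|M|\<close>. The descent also ends for \<open>M\<close> outside the subgroup; the letters
  split off then spell a right factor of \<open>M\<close>, and only the final comparison with the
  identity separates the two cases. Programs can only test, push and pop single bits, which shapes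
  the rest. As \<open>k\<close> is fixed, multiplication by \<open>k\<close> is unrolled into
  \<open>k\<close> additions when the program is built. The width is fixed once from the number of
  input digits and stays sufficient because the complexity never rises. Two complexities are not
  compared digit by digit: their difference is accumulated and its sign digit read. A rejected step
  is undone by the opposite step, so no copy of the matrix is kept.\<close>

definition gen_mat :: "generator \<Rightarrow> int \<Rightarrow> int^2^2" where
  "gen_mat g j = (case g of GenA \<Rightarrow> matA j | GenB \<Rightarrow> matB j)"

lemma gen_mat_entries [simp]:
  "matA j $ 1 $ 1 = 1" "matA j $ 1 $ 2 = j" "matA j $ 2 $ 1 = 0" "matA j $ 2 $ 2 = 1"
  "matB j $ 1 $ 1 = 1" "matB j $ 1 $ 2 = 0" "matB j $ 2 $ 1 = j" "matB j $ 2 $ 2 = 1"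
  by (simp_all add: matA_def matB_def)

lemma mat2_eq_iff:
  "M = N \<longleftrightarrow> M$1$1 = N$1$1 \<and> M$1$2 = N$1$2 \<and> M$2$1 = N$2$1 \<and> M$2$2 = N$2$2"
  for M N :: "int^2^2"
  by (auto simp: vec_eq_iff forall_2)

lemma mat2_mult_entry: "(M ** N) $ i $ j = M$i$1 * N$1$j + M$i$2 * N$2$j"
  for M N :: "int^2^2"
  by (simp add: matrix_matrix_mult_def sum_2)

lemma mat2_one_entries [simp]:
  "(mat 1 :: int^2^2) $ 1 $ 1 = 1" "(mat 1 :: int^2^2) $ 1 $ 2 = 0"
  "(mat 1 :: int^2^2) $ 2 $ 1 = 0" "(mat 1 :: int^2^2) $ 2 $ 2 = 1"
  by (simp_all add: mat_def)

lemma gen_mat_mult: "gen_mat g i ** gen_mat g j = gen_mat g (i + j)"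
  by (simp add: mat2_eq_iff mat2_mult_entry gen_mat_def split: generator.split)

lemma gen_mat_0 [simp]: "gen_mat g 0 = mat 1"
  by (simp add: mat2_eq_iff gen_mat_def split: generator.split)

lemma gen_mat_in_SL2Z: "gen_mat g j \<in> carrier SL2Z"
  by (cases g) (simp_all add: gen_mat_def matA_in_SL2Z matB_in_SL2Z)

lemma SL2Z_mult [simp]: "M \<otimes>\<^bsub>SL2Z\<^esub> N = M ** N"
  and SL2Z_one [simp]: "\<one>\<^bsub>SL2Z\<^esub> = mat 1"
  by (simp_all add: SL2Z_def)

lemma inv_gen_mat: "inv\<^bsub>SL2Z\<^esub> (gen_mat g j) = gen_mat g (- j)"
  by (rule group.inv_equality[OF group_SL2Z]) (simp_all add: gen_mat_mult gen_mat_in_SL2Z)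

lemma letter_val_eq: "letter_val k (g, neg) = gen_mat g (if neg then - k else k)"
  using inv_gen_mat[of GenA k] inv_gen_mat[of GenB k]
  by (cases g) (simp_all add: gen_mat_def)

section \<open>Reduced words as alternating products of powers\<close>

inductive alternating :: "int \<Rightarrow> generator \<Rightarrow> int^2^2 \<Rightarrow> bool" for k where
  base: "e \<noteq> 0 \<Longrightarrow> alternating k g (gen_mat g (k * e))"
| step: "alternating k h N \<Longrightarrow> h \<noteq> g \<Longrightarrow> e \<noteq> 0 \<Longrightarrow> alternating k g (N ** gen_mat g (k * e))"

definition alternating_or_one :: "int \<Rightarrow> int^2^2 \<Rightarrow> bool" where
  "alternating_or_one k M \<longleftrightarrow> M = mat 1 \<or> (\<exists>g. alternating k g M)"

text \<open>If the last factor is already a power of \<open>g\<close>, the exponents merge; their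
  sum may vanish, which uncovers the shorter product \<open>N\<close>. Hence \<open>step'\<close>
  admits every exponent \<open>i\<close>.\<close>

lemma alternating_or_one_mult:
  assumes "alternating_or_one k M"
  shows "alternating_or_one k (M ** gen_mat g (k * e))"
proof (cases "e = 0")
  case True
  then show ?thesis using assms by simp
next
  case False
  have step': "alternating_or_one k (N ** gen_mat g (k * i))"
    if "N = mat 1 \<or> (\<exists>h. alternating k h N \<and> h \<noteq> g)" for N i
    using that alternating.intros[where k = k and g = g and e = i]
    by (cases "i = 0") (auto simp: alternating_or_one_def)
  consider "M = mat 1" | h where "alternating k h M" "h \<noteq> g" | "alternating k g M"
    using assms by (auto simp: alternating_or_one_def)
  then show ?thesis
  proof cases
    case 3
    then obtain N i where N: "M = N ** gen_mat g (k * i)"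
      "N = mat 1 \<or> (\<exists>h. alternating k h N \<and> h \<noteq> g)"
      by (cases rule: alternating.cases) (metis matrix_mul_lid, blast)
    have "M ** gen_mat g (k * e) = N ** gen_mat g (k * (i + e))"
      by (simp add: N(1) gen_mat_mult distrib_left flip: matrix_mul_assoc)
    then show ?thesis using step'[OF N(2)] by simp
  qed (use step' in blast)+
qed

lemma generate_alternating:
  assumes "M \<in> generate SL2Z {matA k, matB k}"
  shows "alternating_or_one k M"
proof -
  \<comment> \<open>The left factor \<open>N\<close> makes the induction work: a product is absorbed
    factor by factor, so alternating products only have to be extended on the right.\<close>
  have "alternating_or_one k (N ** M)" if "alternating_or_one k N" for N
    using assms that
  proof (induction arbitrary: N)
    case (incl h)
    then show ?case
      using alternating_or_one_mult[of k N GenA 1] alternating_or_one_mult[of k N GenB 1]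
      by (auto simp: gen_mat_def)
  next
    case (inv h)
    then show ?case
      using alternating_or_one_mult[of k N GenA "- 1"] alternating_or_one_mult[of k N GenB "- 1"]
        inv_gen_mat[of GenA k] inv_gen_mat[of GenB k]
      by (auto simp: gen_mat_def)
  qed (simp_all add: matrix_mul_assoc)
  then show ?thesis
    by (metis alternating_or_one_def matrix_mul_lid)
qed

section \<open>Ping-pong inequalities and strict descent\<close>

lemma abs_dominated_shift:
  fixes a b k e :: int
  assumes "\<bar>b\<bar> < \<bar>a\<bar>" "k \<ge> 2" "e \<noteq> 0"
  shows "\<bar>a\<bar> < \<bar>b + k * e * a\<bar>" "\<bar>b + k * (e - sgn e) * a\<bar> < \<bar>b + k * e * a\<bar>"
proof -
  \<comment> \<open>The case of positive \<open>p\<close>: the multiple is at least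
    \<open>2 * p\<close> because \<open>k \<ge> 2\<close>, and \<open>q\<close> can take away less
    than \<open>p\<close>.\<close>
  have *: "p < q + k * i * p \<and> \<bar>q + k * (i - 1) * p\<bar> < q + k * i * p"
    if p: "\<bar>q\<bar> < p" and i: "i \<ge> 1" for p q i :: int
  proof -
    have "2 * p \<le> k * p" using assms(2) p by (intro mult_right_mono) auto
    moreover have "0 \<le> k * (i - 1) * p" using assms(2) p i by simp
    moreover have "k * i * p = k * (i - 1) * p + k * p" by (simp add: algebra_simps)
    ultimately show ?thesis using p by linarith
  qed
  \<comment> \<open>Multiplication by this sign reduces everything to \<open>p = |a|\<close>,
    \<open>q = u * b\<close>, \<open>i = |e|\<close>.\<close>
  define u where "u = sgn (a * e)"
  have "a \<noteq> 0" using assms(1) by auto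
  then have u: "u * a * e = \<bar>a\<bar> * \<bar>e\<bar>" "\<bar>u\<bar> = 1" "u * a * sgn e = \<bar>a\<bar>"
    using assms(3) by (auto simp: u_def sgn_mult abs_if sgn_if zero_less_mult_iff)
  have "\<bar>u * b\<bar> < \<bar>a\<bar>" using assms(1) u(2) by (simp add: abs_mult)
  moreover have "\<bar>e\<bar> \<ge> 1" using assms(3) by simp
  ultimately have less: "\<bar>a\<bar> < u * b + k * \<bar>e\<bar> * \<bar>a\<bar>"
    "\<bar>u * b + k * (\<bar>e\<bar> - 1) * \<bar>a\<bar>\<bar> < u * b + k * \<bar>e\<bar> * \<bar>a\<bar>"
    using * by blast+
  then have pos: "\<bar>u * b + k * \<bar>e\<bar> * \<bar>a\<bar>\<bar> = u * b + k * \<bar>e\<bar> * \<bar>a\<bar>"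
    by (intro abs_of_nonneg order.trans[OF abs_ge_zero[of a]]) simp
  have eq: "u * (b + k * e * a) = u * b + k * (u * a * e)"
    "u * (b + k * (e - sgn e) * a) = u * b + k * (u * a * e - u * a * sgn e)"
    by (simp_all add: algebra_simps)
  have "u * b + k * \<bar>e\<bar> * \<bar>a\<bar> = u * (b + k * e * a)"
    "u * b + k * (\<bar>e\<bar> - 1) * \<bar>a\<bar> = u * (b + k * (e - sgn e) * a)"
    unfolding eq u(1,3) by (simp_all add: algebra_simps)
  then have "\<bar>u * b + k * \<bar>e\<bar> * \<bar>a\<bar>\<bar> = \<bar>b + k * e * a\<bar>"
    "\<bar>u * b + k * (\<bar>e\<bar> - 1) * \<bar>a\<bar>\<bar> = \<bar>b + k * (e - sgn e) * a\<bar>"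
    using u(2) by (simp_all add: abs_mult)
  then show "\<bar>a\<bar> < \<bar>b + k * e * a\<bar>" "\<bar>b + k * (e - sgn e) * a\<bar> < \<bar>b + k * e * a\<bar>"
    using less pos by simp_all
qed

definition column_dominant :: "generator \<Rightarrow> int^2^2 \<Rightarrow> bool" where
  "column_dominant g M \<longleftrightarrow> (case g of
     GenA \<Rightarrow> \<bar>M$1$1\<bar> < \<bar>M$1$2\<bar> \<and> \<bar>M$2$1\<bar> < \<bar>M$2$2\<bar>
   | GenB \<Rightarrow> \<bar>M$1$2\<bar> < \<bar>M$1$1\<bar> \<and> \<bar>M$2$2\<bar> < \<bar>M$2$1\<bar>)"

text \<open>In each row a nonzero power of \<open>g\<close> adds a multiple of the dominant entry to
  the smaller one, and by \<open>abs_dominated_shift(1)\<close> the two exchange roles.\<close>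

lemma alternating_column_dominant:
  assumes "alternating k g M" "k \<ge> 2"
  shows "column_dominant g M"
  using assms(1)
proof induction
  case (base e g)
  then show ?case
    using assms(2) abs_dominated_shift(1)[of 0 1 k e]
    by (simp add: column_dominant_def gen_mat_def split: generator.split)
next
  case (step h N g e)
  show ?case
  proof (cases g)
    case GenA
    then have "h = GenB" using step.hyps(2) by (cases h) auto
    then show ?thesis using GenA step assms(2)
      abs_dominated_shift(1)[of "N$1$2" "N$1$1" k e] abs_dominated_shift(1)[of "N$2$2" "N$2$1" k e]
      by (simp add: column_dominant_def gen_mat_def mat2_mult_entry algebra_simps)
  next
    case GenB
    then have "h = GenA" using step.hyps(2) by (cases h) auto
    then show ?thesis using GenB step assms(2)
      abs_dominated_shift(1)[of "N$1$1" "N$1$2" k e] abs_dominated_shift(1)[of "N$2$1" "N$2$2" k e]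
      by (simp add: column_dominant_def gen_mat_def mat2_mult_entry algebra_simps)
  qed
qed

lemma complexity_eq:
  "int (complexity M) = \<bar>M$1$1\<bar> + \<bar>M$1$2\<bar> + \<bar>M$2$1\<bar> + \<bar>M$2$2\<bar>"
  by (simp add: complexity_def sum_2)

text \<open>Cancelling one unit of the last exponent changes only the column on which
  \<open>g\<close> acts; the other column dominates in the prefix \<open>N\<close>, so
  \<open>abs_dominated_shift(2)\<close> applies in both rows.\<close>

lemma alternating_descent:
  assumes "alternating k g M" "k \<ge> 2"
  shows "\<exists>neg. complexity (M ** gen_mat g (if neg then - k else k)) < complexity M"
proof -
  obtain N e where N: "M = N ** gen_mat g (k * e)" "e \<noteq> 0"
    "N = mat 1 \<or> (\<exists>h. alternating k h N \<and> h \<noteq> g)"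
    using assms(1) by (cases rule: alternating.cases) (metis matrix_mul_lid, blast)
  have red: "M ** gen_mat g (- (k * sgn e)) = N ** gen_mat g (k * (e - sgn e))"
    by (simp add: N(1) gen_mat_mult right_diff_distrib flip: matrix_mul_assoc)
  have dom: "column_dominant (case g of GenA \<Rightarrow> GenB | GenB \<Rightarrow> GenA) N" if N1: "N \<noteq> mat 1"
  proof -
    obtain h where "alternating k h N" "h \<noteq> g" using N(3) N1 by blast
    then show ?thesis
      using alternating_column_dominant[OF _ assms(2)] by (cases h; cases g) auto
  qed
  have "int (complexity (N ** gen_mat g (k * (e - sgn e)))) < int (complexity M)"
  \<comment> \<open>The identity has no dominant column in the strict sense, so a single power is
    treated directly; its only changing entry is \<open>k * e\<close>, the case
    \<open>b = 0\<close>, \<open>a = 1\<close>.\<close>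
  proof (cases "N = mat 1")
    case True
    then show ?thesis
      using abs_dominated_shift(2)[of 0 1 k e] assms(2) N(1,2)
      by (cases g) (simp_all add: complexity_eq mat2_mult_entry gen_mat_def)
  next
    case False
    note dom = dom[OF this]
    show ?thesis
    proof (cases g)
      case GenA
      then show ?thesis
        using dom assms(2) N(2)
          abs_dominated_shift(2)[of "N$1$2" "N$1$1" k e] abs_dominated_shift(2)[of "N$2$2" "N$2$1" k e]
        by (simp add: N(1) complexity_eq column_dominant_def gen_mat_def mat2_mult_entry ac_simps)
    next
      case GenB
      then show ?thesis
        using dom assms(2) N(2)
          abs_dominated_shift(2)[of "N$1$1" "N$1$2" k e] abs_dominated_shift(2)[of "N$2$1" "N$2$2" k e]
        by (simp add: N(1) complexity_eq column_dominant_def gen_mat_def mat2_mult_entry ac_simps)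
    qed
  qed
  then have "complexity (M ** gen_mat g (- (k * sgn e))) < complexity M"
    by (simp add: red)
  moreover have "- (k * sgn e) = (if e > 0 then - k else k)"
    using N(2) by (simp add: sgn_if)
  ultimately show ?thesis by metis
qed

lemma generate_irreducible:
  assumes "M \<in> generate SL2Z {matA k, matB k}" "k \<ge> 2"
    and "\<And>g neg. \<not> complexity (M ** gen_mat g (if neg then - k else k)) < complexity M"
  shows "M = mat 1"
  using generate_alternating[OF assms(1)] alternating_descent[OF _ assms(2)] assms(3)
  unfolding alternating_or_one_def by blast

lemma word_val_simps [simp]:
  "word_val k [] = mat 1" "word_val k (l # w) = letter_val k l ** word_val k w"
  by (simp_all add: word_val_def)

lemma word_val_in_generate: "word_val k w \<in> generate SL2Z {matA k, matB k}"
proof (induction w)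
  case Nil
  show ?case using generate.one[of SL2Z] by simp
next
  case (Cons l w)
  obtain g neg where l: "l = (g, neg)" by (cases l)
  have "letter_val k l \<in> generate SL2Z {matA k, matB k}"
    by (cases g) (auto simp: l Let_def intro: generate.intros)
  from generate.eng[OF this Cons.IH] show ?case by simp
qed

section \<open>Running time bounds for programs\<close>

text \<open>An upper bound instead of the exact time, so that branches and loop passes of different
  cost can share one estimate.\<close>

definition runs :: "program \<Rightarrow> store \<Rightarrow> nat \<Rightarrow> store \<Rightarrow> bool" where
  "runs p s T s' \<longleftrightarrow> (\<exists>t\<le>T. exec p s t s')"

lemma runs_mono: "runs p s T s' \<Longrightarrow> T \<le> U \<Longrightarrow> runs p s U s'"
  unfolding runs_def by (meson order_trans)

lemma runs_Seq: "runs p s T s' \<Longrightarrow> runs q s' U s'' \<Longrightarrow> runs (Seq p q) s (T + U) s''"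
  unfolding runs_def by (meson add_mono exec.Seq)

lemma runs_Cond:
  "runs (if holds e s then p else q) s T s' \<Longrightarrow> runs (Cond e p q) s (1 + T) s'"
  unfolding runs_def by (metis add_left_mono exec.CondFalse exec.CondTrue)

lemma runs_WhileFalse: "\<not> holds e s \<Longrightarrow> runs (While e p) s 1 s"
  unfolding runs_def by (meson exec.WhileFalse order_refl)

lemma runs_WhileTrue:
  "holds e s \<Longrightarrow> runs p s T s' \<Longrightarrow> runs (While e p) s' U s'' \<Longrightarrow>
    runs (While e p) s (1 + T + U) s''"
  unfolding runs_def by (meson add_mono exec.WhileTrue order_refl)

fun loop_free :: "program \<Rightarrow> bool" where
  "loop_free (Seq p q) = (loop_free p \<and> loop_free q)"
| "loop_free (Cond e p q) = (loop_free p \<and> loop_free q)"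
| "loop_free (While e p) = False"
| "loop_free _ = True"

text \<open>Together with \<open>straight_effect\<close> this lets the simplifier execute loop-free
  code symbolically. The clauses for \<open>While\<close> are dummies, excluded by
  \<open>loop_free\<close>.\<close>

fun straight_cost :: "program \<Rightarrow> nat" where
  "straight_cost (Seq p q) = straight_cost p + straight_cost q"
| "straight_cost (Cond e p q) = 1 + max (straight_cost p) (straight_cost q)"
| "straight_cost (While e p) = 0"
| "straight_cost _ = 1"

fun straight_effect :: "program \<Rightarrow> store \<Rightarrow> store" where
  "straight_effect Skip s = s"
| "straight_effect (Push x b) s = s(x := b # s x)"
| "straight_effect (Pop x) s = s(x := tl (s x))"
| "straight_effect (Seq p q) s = straight_effect q (straight_effect p s)"
| "straight_effect (Cond e p q) s =
     (if holds e s then straight_effect p s else straight_effect q s)"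
| "straight_effect (While e p) s = s"

lemma runs_loop_free:
  "loop_free p \<Longrightarrow> runs p s (straight_cost p) (straight_effect p s)"
proof (induction p arbitrary: s)
  case (Seq p q)
  then show ?case by (auto intro: runs_Seq)
next
  case (Cond e p q)
  have "runs (if holds e s then p else q) s (max (straight_cost p) (straight_cost q))
      (straight_effect (Cond e p q) s)"
    using Cond.prems runs_mono[OF Cond.IH(1)] runs_mono[OF Cond.IH(2)] by simp
  from runs_Cond[OF this] show ?case by simp
qed (auto simp: runs_def intro: exec.intros[unfolded One_nat_def])

lemma runs_loop_freeI:
  "loop_free p \<Longrightarrow> straight_cost p \<le> T \<Longrightarrow> straight_effect p s = s' \<Longrightarrow> runs p s T s'"
  using runs_loop_free runs_mono by blast

fun repeat :: "nat \<Rightarrow> program \<Rightarrow> program" where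
  "repeat 0 p = Skip"
| "repeat (Suc n) p = Seq p (repeat n p)"

lemma runs_repeat:
  assumes "\<And>i. i < n \<Longrightarrow> runs p (f i) T (f (Suc i))"
  shows "runs (repeat n p) (f 0) (n * T + 1) (f n)"
  using assms
proof (induction n arbitrary: f)
  case 0
  show ?case by (rule runs_loop_freeI) simp_all
next
  case (Suc n)
  have "runs (repeat n p) (f (Suc 0)) (n * T + 1) (f (Suc n))"
    using Suc.IH[of "\<lambda>i. f (Suc i)"] Suc.prems by simp
  with Suc.prems[of 0] show ?case
    using runs_Seq by fastforce
qed


section \<open>Fixed-width binary arithmetic\<close>

text \<open>Two's complement with \<open>L\<close> digits, least significant digit first.\<close>

fun enc :: "nat \<Rightarrow> int \<Rightarrow> bool list" where
  "enc 0 z = []"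
| "enc (Suc L) z = odd z # enc L (z div 2)"

lemma length_enc [simp]: "length (enc L z) = L"
  by (induction L arbitrary: z) simp_all

lemma enc_eq_Nil_iff [simp]: "enc L z = [] \<longleftrightarrow> L = 0"
  by (cases L) simp_all

lemma enc_0: "enc L 0 = replicate L False"
  by (induction L) simp_all

text \<open>Floor division by 2 preserves the sign and halves the range, until a single digit is
  left and \<open>z\<close> is \<open>- 1\<close> or \<open>0\<close>.\<close>

lemma hd_rev_enc:
  assumes "L > 0" "- (2 ^ (L - 1)) \<le> z" "z < 2 ^ (L - 1)"
  shows "hd (rev (enc L z)) \<longleftrightarrow> z < 0"
  using assms
proof (induction L arbitrary: z)
  case (Suc L)
  show ?case
  proof (cases L)
    case 0
    then have "z = - 1 \<or> z = 0" using Suc.prems by auto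
    then show ?thesis using 0 by auto
  next
    case (Suc L')
    have "- (2 ^ (L - 1)) \<le> z div 2" "z div 2 < 2 ^ (L - 1)"
      using Suc.prems Suc by auto
    then have "hd (rev (enc L (z div 2))) \<longleftrightarrow> z div 2 < 0"
      using Suc.IH Suc by blast
    then show ?thesis using Suc by (auto simp: hd_append split: if_splits)
  qed
qed simp

text \<open>Reads \<open>L\<close> digits in the way a program sees them: an exhausted stack delivers zeros.\<close>

fun ext :: "nat \<Rightarrow> bool list \<Rightarrow> bool list" where
  "ext 0 xs = []"
| "ext (Suc L) xs = (xs \<noteq> [] \<and> hd xs) # ext L (tl xs)"

lemma ext_enc [simp]: "ext L (enc L z) = enc L z"
  by (induction L arbitrary: z) simp_all

lemma ext_nat_digits:
  "length (nat_digits n) \<le> L \<Longrightarrow> ext L (nat_digits n) = enc L (int n)"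
proof (induction L arbitrary: n)
  case (Suc L)
  show ?case
  proof (cases "n = 0")
    case True
    have "ext L [] = enc L 0"
      by (induction L) simp_all
    then show ?thesis using True by (simp add: nat_digits.simps)
  next
    case False
    then show ?thesis using Suc
      by (subst nat_digits.simps, subst (asm) (2) nat_digits.simps) (simp add: zdiv_int)
  qed
qed simp

text \<open>Stacks 0 to 3 hold the input, 4 and 5 the output, 6 to 9 the entries of the current matrix,
  10 the change of its complexity, 11 the carry, and 15 a counter controlling the main loop; 12
  and 13 are scratch space, empty between operations.\<close>

abbreviation seq (infixr ";;" 60) where "p ;; q \<equiv> Seq p q"

text \<open>No instruction copies a bit. A bit is remembered by the control flow: \<open>f\<close>
  supplies one continuation for each value, and an empty stack reads as zero.\<close>

definition cond_bit :: "nat \<Rightarrow> (bool \<Rightarrow> program) \<Rightarrow> program" where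
  "cond_bit x f = Cond (Top x) (f True) (f False)"

definition move :: "nat \<Rightarrow> nat \<Rightarrow> program" where
  "move x y = While (Nonempty x) (cond_bit x (\<lambda>b. Pop x ;; Push y b))"

lemma runs_move:
  assumes "x \<noteq> y"
  shows "runs (move x y) s (4 * length (s x) + 1) (s(x := [], y := rev (s x) @ s y))"
  using assms
proof (induction "s x" arbitrary: s)
  case Nil
  then show ?case
    using runs_WhileFalse[of "Nonempty x" s] by (simp add: move_def fun_upd_idem)
next
  case (Cons b bs)
  define s1 where "s1 = s(x := bs, y := b # s y)"
  have body: "runs (cond_bit x (\<lambda>b. Pop x ;; Push y b)) s 3 s1"
    using Cons(2)[symmetric] Cons(3)
    by (intro runs_loop_freeI) (auto simp: cond_bit_def s1_def)
  have "runs (move x y) s1 (4 * length bs + 1) (s1(x := [], y := rev bs @ s1 y))"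
    using Cons(1)[of s1] Cons(3) by (simp add: s1_def)
  from runs_WhileTrue[OF _ body this[unfolded move_def]] Cons(2)[symmetric]
  have "runs (move x y) s (1 + 3 + (4 * length bs + 1)) (s1(x := [], y := rev bs @ s1 y))"
    by (simp add: move_def)
  moreover have "s1(x := [], y := rev bs @ s1 y) = s(x := [], y := rev (s x) @ s y)"
    using Cons(2)[symmetric] Cons(3) by (auto simp: s1_def fun_eq_iff)
  ultimately show ?case using Cons(2)[symmetric] by (simp add: algebra_simps)
qed

definition signed :: "bool \<Rightarrow> int \<Rightarrow> int" where
  "signed neg y = (if neg then - y else y)"

text \<open>The last digit pushed is the carry of an addition or the borrow of a subtraction.\<close>

definition add_digit :: "bool \<Rightarrow> nat \<Rightarrow> nat \<Rightarrow> program" where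
  "add_digit neg d x =
     cond_bit d (\<lambda>a. cond_bit x (\<lambda>b. cond_bit 11 (\<lambda>c.
       Pop d ;; Pop x ;; Pop 11 ;; Push 12 (a \<noteq> (b \<noteq> c)) ;; Push 13 b ;;
       Push 11 ((a \<noteq> neg) \<and> b \<or> (a \<noteq> neg) \<and> c \<or> b \<and> c))))"

text \<open>Sum and difference have the same lowest digit. The carry is the majority of the three
  digits, and the borrow is the same majority with the digit of \<open>x\<close> flipped.\<close>

lemma signed_digit:
  fixes x y :: int
  shows "odd (x + signed neg (y + of_bool c)) \<longleftrightarrow> (odd x \<noteq> (odd y \<noteq> c))"
    and "(x + signed neg (y + of_bool c)) div 2 = x div 2 + signed neg (y div 2 +
      of_bool ((odd x \<noteq> neg) \<and> odd y \<or> (odd x \<noteq> neg) \<and> c \<or> odd y \<and> c))"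
  by (cases neg; cases c; cases "odd x"; cases "odd y";
      simp add: signed_def; presburger)+

text \<open>Only \<open>d\<close> controls the loop, so \<open>y\<close> may be shorter and is then
  read as padded with zeros. The last carry \<open>c'\<close> is left unspecified:
  \<open>enc\<close> retains only the residue modulo \<open>2 ^ L\<close>.\<close>

lemma runs_add_digits:
  assumes "s d = enc L x" "ext L (s y) = enc L v" "s 11 = [c]" "d < 11" "y < 11" "d \<noteq> y"
  shows "\<exists>c'. runs (While (Nonempty d) (add_digit neg d y)) s (10 * L + 1)
    (s(d := [], y := drop L (s y), 11 := [c'],
       12 := rev (enc L (x + signed neg (v + of_bool c))) @ s 12, 13 := rev (enc L v) @ s 13))"
  using assms
proof (induction L arbitrary: s x v c)
  case 0
  have eq: "s(d := [], y := drop 0 (s y), 11 := [c],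
      12 := rev (enc 0 (x + signed neg (v + of_bool c))) @ s 12, 13 := rev (enc 0 v) @ s 13) = s"
    using 0 by (auto simp: fun_eq_iff)
  have "runs (While (Nonempty d) (add_digit neg d y)) s (10 * 0 + 1) s"
    using runs_WhileFalse[of "Nonempty d" s] 0(1) by simp
  then show ?case
    by (subst (asm) (2) eq[symmetric]) (rule exI)
next
  case (Suc L)
  define c1 where "c1 = ((odd x \<noteq> neg) \<and> odd v \<or> (odd x \<noteq> neg) \<and> c \<or> odd v \<and> c)"
  define s1 where "s1 = s(d := enc L (x div 2), y := tl (s y), 11 := [c1],
    12 := (odd x \<noteq> (odd v \<noteq> c)) # s 12, 13 := odd v # s 13)"
  have y: "(s y \<noteq> [] \<and> hd (s y)) = odd v" "ext L (tl (s y)) = enc L (v div 2)"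
    using Suc.prems by simp_all
  have body: "runs (add_digit neg d y) s 9 s1"
    using Suc.prems(1,3-) y(1)
    by (intro runs_loop_freeI) (auto simp: add_digit_def cond_bit_def s1_def c1_def fun_eq_iff)
  have "s1 d = enc L (x div 2)" "ext L (s1 y) = enc L (v div 2)" "s1 11 = [c1]"
    using Suc.prems(4-) y(2) by (auto simp: s1_def)
  from Suc.IH[OF this Suc.prems(4-)]
  obtain c' where "runs (While (Nonempty d) (add_digit neg d y)) s1 (10 * L + 1)
    (s1(d := [], y := drop L (s1 y), 11 := [c'],
       12 := rev (enc L (x div 2 + signed neg (v div 2 + of_bool c1))) @ s1 12,
       13 := rev (enc L (v div 2)) @ s1 13))" by blast
  from runs_WhileTrue[OF _ body this] Suc.prems(1)
  have R: "runs (While (Nonempty d) (add_digit neg d y)) s (1 + 9 + (10 * L + 1))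
    (s1(d := [], y := drop L (s1 y), 11 := [c'],
       12 := rev (enc L (x div 2 + signed neg (v div 2 + of_bool c1))) @ s1 12,
       13 := rev (enc L (v div 2)) @ s1 13))" by simp
  have digit: "enc (Suc L) (x + signed neg (v + of_bool c)) =
      (odd x \<noteq> (odd v \<noteq> c)) # enc L (x div 2 + signed neg (v div 2 + of_bool c1))"
    "enc (Suc L) v = odd v # enc L (v div 2)"
    by (simp_all only: enc.simps signed_digit c1_def)
  have eq: "s1(d := [], y := drop L (s1 y), 11 := [c'],
       12 := rev (enc L (x div 2 + signed neg (v div 2 + of_bool c1))) @ s1 12,
       13 := rev (enc L (v div 2)) @ s1 13) =
    s(d := [], y := drop (Suc L) (s y), 11 := [c'],
       12 := rev (enc (Suc L) (x + signed neg (v + of_bool c))) @ s 12,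
       13 := rev (enc (Suc L) v) @ s 13)"
    (is "?l = ?r")
  proof
    fix i
    consider "i = d" | "i = y" | "i = 11" | "i = 12" | "i = 13"
      | "i \<noteq> d" "i \<noteq> y" "i \<noteq> 11" "i \<noteq> 12" "i \<noteq> 13" by blast
    then show "?l i = ?r i"
      using Suc.prems(4-) by cases (simp_all add: s1_def drop_Suc digit del: enc.simps(2))
  qed
  have "1 + 9 + (10 * L + 1) = 10 * Suc L + 1" by simp
  from R[unfolded eq this] show ?case by (rule exI[of _ c'])
qed

text \<open>Reading destroys a stack, so the result and a copy of the second operand are collected
  in reverse on 12 and 13 and then moved back.\<close>

definition add :: "bool \<Rightarrow> nat \<Rightarrow> nat \<Rightarrow> program" where
  "add neg d x = Push 11 False ;; While (Nonempty d) (add_digit neg d x) ;; Pop 11 ;;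
     move 12 d ;; move 13 x"

lemma runs_add_ext:
  assumes "s d = enc L x" "ext L (s y) = enc L v" "length (s y) \<le> L"
    and "s 11 = []" "s 12 = []" "s 13 = []" "d < 11" "y < 11" "d \<noteq> y"
  shows "runs (add neg d y) s (18 * L + 5) (s(d := enc L (x + signed neg v), y := enc L v))"
proof -
  have 1: "runs (Push 11 False) s 1 (s(11 := [False]))"
    using assms by (intro runs_loop_freeI) auto
  obtain c where c: "runs (While (Nonempty d) (add_digit neg d y)) (s(11 := [False])) (10 * L + 1)
     (s(d := [], y := [], 11 := [c], 12 := rev (enc L (x + signed neg v)), 13 := rev (enc L v)))"
    using runs_add_digits[of "s(11 := [False])" d L x y v False neg] assms
    by (auto simp: fun_upd_twist)
  have 2: "runs (Pop 11) (s(d := [], y := [], 11 := [c], 12 := rev (enc L (x + signed neg v)),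
      13 := rev (enc L v))) 1
    (s(d := [], y := [], 12 := rev (enc L (x + signed neg v)), 13 := rev (enc L v)))"
    using assms by (intro runs_loop_freeI) (auto simp: fun_eq_iff)
  have 3: "runs (move 12 d) (s(d := [], y := [], 12 := rev (enc L (x + signed neg v)),
      13 := rev (enc L v))) (4 * L + 1)
    (s(d := enc L (x + signed neg v), y := [], 13 := rev (enc L v)))"
    using runs_move[of 12 d "s(d := [], y := [], 12 := rev (enc L (x + signed neg v)),
      13 := rev (enc L v))"] assms
    by (auto elim!: back_subst[of "runs _ _ _"] simp: fun_eq_iff)
  have 4: "runs (move 13 y) (s(d := enc L (x + signed neg v), y := [], 13 := rev (enc L v)))
    (4 * L + 1) (s(d := enc L (x + signed neg v), y := enc L v))"
    using runs_move[of 13 y "s(d := enc L (x + signed neg v), y := [], 13 := rev (enc L v))"] assms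
    by (auto elim!: back_subst[of "runs _ _ _"] simp: fun_eq_iff)
  from runs_Seq[OF 1 runs_Seq[OF c runs_Seq[OF 2 runs_Seq[OF 3 4]]]]
  show ?thesis unfolding add_def by (rule runs_mono) simp
qed

lemma runs_add:
  assumes "s d = enc L x" "s y = enc L v"
    and "s 11 = []" "s 12 = []" "s 13 = []" "d < 11" "y < 11" "d \<noteq> y"
  shows "runs (add neg d y) s (18 * L + 5) (s(d := enc L (x + signed neg v)))"
  using runs_add_ext[of s d L x y v neg] assms
  by (auto elim!: back_subst[of "runs _ _ _"] simp: fun_eq_iff)

text \<open>The sign digit lies at the bottom, so the operand is turned over onto stack 12 to expose
  it. The absolute value is never formed: a negative operand just swaps addition and
  subtraction.\<close>

definition add_abs :: "bool \<Rightarrow> nat \<Rightarrow> nat \<Rightarrow> program" where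
  "add_abs neg d x = move x 12 ;;
     Cond (Top 12) (move 12 x ;; add (\<not> neg) d x) (move 12 x ;; add neg d x)"

lemma runs_add_abs:
  assumes "s d = enc L x" "s y = enc L v" "L > 0" "\<bar>v\<bar> < 2 ^ (L - 1)"
    and "s 11 = []" "s 12 = []" "s 13 = []" "d < 11" "y < 11" "d \<noteq> y"
  shows "runs (add_abs neg d y) s (26 * L + 8) (s(d := enc L (x + signed neg \<bar>v\<bar>)))"
proof -
  define s1 where "s1 = s(y := [], 12 := rev (enc L v))"
  have 1: "runs (move y 12) s (4 * L + 1) s1"
    using runs_move[of y 12 s] assms by (simp add: s1_def)
  have 2: "runs (move 12 y) s1 (4 * L + 1) s"
    using runs_move[of 12 y s1] assms
    by (auto elim!: back_subst[of "runs _ _ _"] simp: s1_def fun_eq_iff)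
  have "holds (Top 12) s1 \<longleftrightarrow> v < 0"
    using hd_rev_enc[of L v] assms by (auto simp: s1_def)
  then have "runs (if holds (Top 12) s1 then move 12 y ;; add (\<not> neg) d y
      else move 12 y ;; add neg d y) s1
    (4 * L + 1 + (18 * L + 5)) (s(d := enc L (x + signed neg \<bar>v\<bar>)))"
    using runs_Seq[OF 2 runs_add[OF assms(1,2,5-), of "if v < 0 then \<not> neg else neg"]]
    by (auto simp: signed_def split: if_splits)
  from runs_Seq[OF 1 runs_Cond[OF this]]
  show ?thesis unfolding add_abs_def by (rule runs_mono) simp
qed

section \<open>The reduction loop\<close>

text \<open>Right multiplication by a generator adds a multiple of one column to the other. The
  register is the upper entry of the changed column; the lower entry is two registers further
  on.\<close>

definition dst_reg :: "generator \<Rightarrow> nat" where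
  "dst_reg g = (case g of GenA \<Rightarrow> 7 | GenB \<Rightarrow> 6)"

definition src_reg :: "generator \<Rightarrow> nat" where
  "src_reg g = (case g of GenA \<Rightarrow> 6 | GenB \<Rightarrow> 7)"

definition load :: "nat \<Rightarrow> int^2^2 \<Rightarrow> store \<Rightarrow> store" where
  "load L M s = s(6 := enc L (M$1$1), 7 := enc L (M$1$2), 8 := enc L (M$2$1), 9 := enc L (M$2$2))"

definition column_op :: "nat \<Rightarrow> generator \<Rightarrow> bool \<Rightarrow> program" where
  "column_op K g neg =
     repeat K (add neg (dst_reg g) (src_reg g) ;; add neg (dst_reg g + 2) (src_reg g + 2))"

lemma load_entry:
  "load L M s (dst_reg g) = enc L (case g of GenA \<Rightarrow> M$1$2 | GenB \<Rightarrow> M$1$1)"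
  "load L M s (dst_reg g + 2) = enc L (case g of GenA \<Rightarrow> M$2$2 | GenB \<Rightarrow> M$2$1)"
  "load L M s (src_reg g) = enc L (case g of GenA \<Rightarrow> M$1$1 | GenB \<Rightarrow> M$1$2)"
  "load L M s (src_reg g + 2) = enc L (case g of GenA \<Rightarrow> M$2$1 | GenB \<Rightarrow> M$2$2)"
  by (simp_all add: load_def dst_reg_def src_reg_def split: generator.split)

lemma load_column_op_step:
  "(load L M s)(dst_reg g := enc L ((case g of GenA \<Rightarrow> M$1$2 | GenB \<Rightarrow> M$1$1) + i *
       (case g of GenA \<Rightarrow> M$1$1 | GenB \<Rightarrow> M$1$2)),
     dst_reg g + 2 := enc L ((case g of GenA \<Rightarrow> M$2$2 | GenB \<Rightarrow> M$2$1) + i *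
       (case g of GenA \<Rightarrow> M$2$1 | GenB \<Rightarrow> M$2$2))) = load L (M ** gen_mat g i) s"
  by (cases g) (simp_all add: load_def dst_reg_def fun_eq_iff mat2_mult_entry gen_mat_def ac_simps)

lemma runs_column_op:
  assumes "s 11 = []" "s 12 = []" "s 13 = []"
  shows "runs (column_op K g neg) (load L M s) (K * (36 * L + 10) + 1)
    (load L (M ** gen_mat g (signed neg (int K))) s)"
proof -
  \<comment> \<open>The state after \<open>i\<close> rounds of additions. Arithmetic is modulo
    \<open>2 ^ L\<close>, so range conditions enter only where a sign digit is read.\<close>
  define f where "f i = load L (M ** gen_mat g (signed neg (int i))) s" for i
  have "runs (add neg (dst_reg g) (src_reg g) ;; add neg (dst_reg g + 2) (src_reg g + 2)) (f i)
      (36 * L + 10) (f (Suc i))" for i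
  proof -
    define N where "N = M ** gen_mat g (signed neg (int i))"
    have reg: "dst_reg g < 9" "src_reg g < 9" "dst_reg g \<noteq> src_reg g" "dst_reg g + 2 \<noteq> src_reg g"
      "src_reg g + 2 \<noteq> dst_reg g"
      by (cases g; simp add: dst_reg_def src_reg_def)+
    have scratch: "load L N s 11 = []" "load L N s 12 = []" "load L N s 13 = []"
      using assms by (simp_all add: load_def)
    have one: "signed neg v = signed neg 1 * v" for v
      by (simp add: signed_def)
    define s1 where "s1 = (load L N s)(dst_reg g := enc L ((case g of GenA \<Rightarrow> N$1$2 | GenB \<Rightarrow> N$1$1) +
        signed neg 1 * (case g of GenA \<Rightarrow> N$1$1 | GenB \<Rightarrow> N$1$2)))"
    have 1: "runs (add neg (dst_reg g) (src_reg g)) (load L N s) (18 * L + 5) s1"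
      unfolding s1_def one[symmetric]
      by (rule runs_add) (use reg scratch in \<open>simp_all add: load_entry\<close>)
    have 2: "runs (add neg (dst_reg g + 2) (src_reg g + 2)) s1 (18 * L + 5)
      (s1(dst_reg g + 2 := enc L ((case g of GenA \<Rightarrow> N$2$2 | GenB \<Rightarrow> N$2$1) + signed neg 1 *
       (case g of GenA \<Rightarrow> N$2$1 | GenB \<Rightarrow> N$2$2))))"
      unfolding one[symmetric]
      by (rule runs_add) (use reg scratch in \<open>simp_all add: s1_def load_entry[simplified]\<close>)
    have "signed neg (int i) + signed neg 1 = signed neg (int (Suc i))"
      by (simp add: signed_def)
    then have "N ** gen_mat g (signed neg 1) = M ** gen_mat g (signed neg (int (Suc i)))"
      by (simp add: N_def gen_mat_mult flip: matrix_mul_assoc)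
    then have "f (Suc i) = load L (N ** gen_mat g (signed neg 1)) s"
      by (simp add: f_def)
    with runs_Seq[OF 1 2] show ?thesis
      unfolding s1_def load_column_op_step f_def N_def by (auto elim: runs_mono)
  qed
  from runs_repeat[of K _ f, OF this]
  have "runs (column_op K g neg) (f 0) (K * (36 * L + 10) + 1) (f K)"
    by (simp only: column_op_def)
  moreover have "f 0 = load L M s" by (simp add: f_def signed_def)
  ultimately show ?thesis by (simp only: f_def)
qed

definition column_norm :: "generator \<Rightarrow> int^2^2 \<Rightarrow> int" where
  "column_norm g M =
     (case g of GenA \<Rightarrow> \<bar>M$1$2\<bar> + \<bar>M$2$2\<bar> | GenB \<Rightarrow> \<bar>M$1$1\<bar> + \<bar>M$2$1\<bar>)"

definition add_column_norm :: "bool \<Rightarrow> generator \<Rightarrow> program" where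
  "add_column_norm neg g = add_abs neg 10 (dst_reg g) ;; add_abs neg 10 (dst_reg g + 2)"

lemma runs_add_column_norm:
  assumes "s 11 = []" "s 12 = []" "s 13 = []" "L > 0" "column_norm g M < 2 ^ (L - 1)"
  shows "runs (add_column_norm neg g) ((load L M s)(10 := enc L z)) (52 * L + 16)
    ((load L M s)(10 := enc L (z + signed neg (column_norm g M))))"
proof -
  define x where "x = (case g of GenA \<Rightarrow> M$1$2 | GenB \<Rightarrow> M$1$1)"
  define x' where "x' = (case g of GenA \<Rightarrow> M$2$2 | GenB \<Rightarrow> M$2$1)"
  have norm: "column_norm g M = \<bar>x\<bar> + \<bar>x'\<bar>"
    by (cases g) (simp_all add: column_norm_def x_def x'_def)
  have entry: "load L M s (dst_reg g) = enc L x" "load L M s (dst_reg g + 2) = enc L x'"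
    by (simp_all add: load_entry[simplified] x_def x'_def)
  have scratch: "load L M s 11 = []" "load L M s 12 = []" "load L M s 13 = []"
    using assms by (simp_all add: load_def)
  have reg: "dst_reg g < 8" by (cases g) (simp_all add: dst_reg_def)
  have "runs (add_abs neg 10 (dst_reg g)) ((load L M s)(10 := enc L z)) (26 * L + 8)
      (((load L M s)(10 := enc L z))(10 := enc L (z + signed neg \<bar>x\<bar>)))"
    by (rule runs_add_abs) (use assms reg scratch entry norm in auto)
  moreover have "runs (add_abs neg 10 (dst_reg g + 2))
      ((load L M s)(10 := enc L (z + signed neg \<bar>x\<bar>))) (26 * L + 8)
      (((load L M s)(10 := enc L (z + signed neg \<bar>x\<bar>)))
        (10 := enc L (z + signed neg \<bar>x\<bar> + signed neg \<bar>x'\<bar>)))"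
    by (rule runs_add_abs) (use assms reg scratch entry norm in auto)
  ultimately have "runs (add_column_norm neg g) ((load L M s)(10 := enc L z))
      (26 * L + 8 + (26 * L + 8))
      ((load L M s)(10 := enc L (z + signed neg \<bar>x\<bar> + signed neg \<bar>x'\<bar>)))"
    unfolding add_column_norm_def using runs_Seq by fastforce
  moreover have "z + signed neg \<bar>x\<bar> + signed neg \<bar>x'\<bar> = z + signed neg (column_norm g M)"
    by (simp add: norm signed_def)
  ultimately show ?thesis by (simp add: runs_mono)
qed

text \<open>The width is not stored as a number; the digits lying on stack 12 serve as the template
  for rebuilding a zero of the right length on stack 10.\<close>

definition reset :: program where
  "reset = While (Nonempty 12) (Pop 12 ;; Push 10 False)"

lemma runs_reset:
  "runs reset s (3 * length (s 12) + 1) (s(10 := replicate (length (s 12)) False @ s 10, 12 := []))"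
proof (induction "s 12" arbitrary: s)
  case Nil
  then show ?case
    using runs_WhileFalse[of "Nonempty 12" s] by (simp add: reset_def fun_upd_idem)
next
  case (Cons b bs)
  define s1 where "s1 = s(12 := bs, 10 := False # s 10)"
  have body: "runs (Pop 12 ;; Push 10 False) s 2 s1"
    using Cons(2)[symmetric] by (intro runs_loop_freeI) (auto simp: s1_def)
  have len: "length (s 12) = Suc (length bs)" by (simp flip: Cons(2))
  have "runs reset s1 (3 * length bs + 1) (s1(10 := replicate (length bs) False @ s1 10, 12 := []))"
    using Cons(1)[of s1] by (simp add: s1_def)
  moreover have "holds (Nonempty 12) s" using len by auto
  ultimately have R: "runs reset s (1 + 2 + (3 * length bs + 1))
      (s1(10 := replicate (length bs) False @ s1 10, 12 := []))"
    using body unfolding reset_def by (intro runs_WhileTrue)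
  have eq: "s1(10 := replicate (length bs) False @ s1 10, 12 := []) =
      s(10 := replicate (length (s 12)) False @ s 10, 12 := [])"
    by (simp add: s1_def fun_eq_iff len replicate_app_Cons_same)
  show ?case using R unfolding eq by (rule runs_mono) (simp add: len)
qed

text \<open>Stack 10 starts at zero, loses the old norm and gains the new one. The recorded letter
  is the inverse of the one multiplied by, since it has to restore the product; its generator bit is
  pushed last to lie on top.\<close>

definition trial :: "nat \<Rightarrow> generator \<Rightarrow> bool \<Rightarrow> program" where
  "trial K g neg =
     add_column_norm True g ;; column_op K g neg ;; add_column_norm False g ;; move 10 12 ;;
     Cond (Top 12)
       (reset ;; Push 5 (\<not> neg) ;; Push 5 (g = GenB) ;; Push 15 True)
       (reset ;; column_op K g (\<not> neg))"

text \<open>The column that is not changed cancels from the difference.\<close>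

lemma complexity_gen_mat:
  "int (complexity (M ** gen_mat g i)) - int (complexity M) =
     column_norm g (M ** gen_mat g i) - column_norm g M"
  by (cases g) (simp_all add: complexity_eq column_norm_def gen_mat_def mat2_mult_entry)

lemma column_norm_bounds:
  "0 \<le> column_norm g M" "column_norm g M \<le> int (complexity M)"
  "column_norm g (M ** gen_mat g i) \<le> (1 + \<bar>i\<bar>) * int (complexity M)"
proof -
  show "0 \<le> column_norm g M" "column_norm g M \<le> int (complexity M)"
    by (cases g; simp add: complexity_eq column_norm_def)+
  have tri: "\<bar>a + i * b\<bar> \<le> \<bar>a\<bar> + \<bar>i\<bar> * \<bar>b\<bar>" for a b
    using abs_triangle_ineq[of a "i * b"] by (simp add: abs_mult)
  have "column_norm g (M ** gen_mat g i) \<le> column_norm g M + \<bar>i\<bar> * int (complexity M)"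
  proof (cases g)
    case GenA
    have "\<bar>i\<bar> * (\<bar>M$1$1\<bar> + \<bar>M$2$1\<bar>) \<le> \<bar>i\<bar> * int (complexity M)"
      by (intro mult_left_mono) (simp_all add: complexity_eq)
    then show ?thesis
      using GenA tri[of "M$1$2" "M$1$1"] tri[of "M$2$2" "M$2$1"]
      by (simp add: column_norm_def gen_mat_def mat2_mult_entry algebra_simps)
  next
    case GenB
    have "\<bar>i\<bar> * (\<bar>M$1$2\<bar> + \<bar>M$2$2\<bar>) \<le> \<bar>i\<bar> * int (complexity M)"
      by (intro mult_left_mono) (simp_all add: complexity_eq)
    then show ?thesis
      using GenB tri[of "M$1$1" "M$1$2"] tri[of "M$2$1" "M$2$2"]
      by (simp add: column_norm_def gen_mat_def mat2_mult_entry algebra_simps)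
  qed
  with \<open>column_norm g M \<le> int (complexity M)\<close>
  show "column_norm g (M ** gen_mat g i) \<le> (1 + \<bar>i\<bar>) * int (complexity M)"
    by (simp add: algebra_simps)
qed

text \<open>The term \<open>72 * K\<close> pays for two column operations, the attempt and its
  reversal. The factor \<open>1 + int K\<close> is the possible growth of the changed
  column.\<close>

lemma runs_trial:
  fixes K :: nat and M :: "int^2^2" and g :: generator and neg :: bool
  defines "N \<equiv> M ** gen_mat g (signed neg (int K))"
  assumes s: "s 10 = enc L 0" "s 11 = []" "s 12 = []" "s 13 = []"
    and L: "L > 0" "(1 + int K) * int (complexity M) < 2 ^ (L - 1)"
  shows "runs (trial K g neg) (load L M s) ((72 * K + 120) * (L + 1))
    (if complexity N < complexity M
     then (load L N s)(5 := (g = GenB) # (\<not> neg) # s 5, 15 := True # s 15)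
     else load L M s)"
proof -
  have abs_signed: "\<bar>signed neg (int K)\<bar> = int K" by (simp add: signed_def)
  have normN: "column_norm g N < 2 ^ (L - 1)"
    using column_norm_bounds(3)[of g M "signed neg (int K)"] L(2)
    unfolding N_def abs_signed by linarith
  have "int (complexity M) \<le> (1 + int K) * int (complexity M)"
    by (simp add: algebra_simps)
  then have normM: "column_norm g M < 2 ^ (L - 1)"
    using column_norm_bounds(2)[of g M] L(2) by linarith
  define z where "z = column_norm g N - column_norm g M"
  have sgn: "z < 0 \<longleftrightarrow> complexity N < complexity M"
    using complexity_gen_mat[of M g "signed neg (int K)"] unfolding z_def N_def by linarith
  \<comment> \<open>Both norms lie between 0 and \<open>2 ^ (L - 1)\<close>, so their difference
    still fits and its top digit is its sign.\<close>
  have zb: "- (2 ^ (L - 1)) \<le> z" "z < 2 ^ (L - 1)"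
    using normM normN column_norm_bounds(1)[of g M] column_norm_bounds(1)[of g N]
    unfolding z_def by linarith+
  have put: "(load L A s)(10 := xs) = load L A (s(10 := xs))" for A xs
    by (simp add: load_def fun_upd_twist)
  have keep: "(load L A s)(10 := enc L 0) = load L A s" for A
    using s(1) by (simp add: load_def fun_eq_iff)
  have 1: "runs (add_column_norm True g) (load L M s) (52 * L + 16)
      (load L M (s(10 := enc L (- column_norm g M))))"
    using runs_add_column_norm[of s L g M True 0] s L normM
    by (simp add: keep signed_def flip: put)
  have 2: "runs (column_op K g neg) (load L M (s(10 := enc L (- column_norm g M))))
      (K * (36 * L + 10) + 1) (load L N (s(10 := enc L (- column_norm g M))))"
    unfolding N_def by (rule runs_column_op) (use s in auto)
  have 3: "runs (add_column_norm False g) (load L N (s(10 := enc L (- column_norm g M))))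
      (52 * L + 16) (load L N (s(10 := enc L z)))"
    using runs_add_column_norm[of s L g N False "- column_norm g M"] s L normN
    by (simp add: z_def signed_def flip: put)
  define s1 where "s1 = (load L N s)(10 := [], 12 := rev (enc L z))"
  have 4: "runs (move 10 12) (load L N (s(10 := enc L z))) (4 * L + 1) s1"
    using runs_move[of 10 12 "load L N (s(10 := enc L z))"] s(3)
    by (simp add: s1_def flip: put) (simp add: load_def)
  have len: "length (s1 12) = L" by (simp add: s1_def)
  have "s1(10 := replicate (length (s1 12)) False @ s1 10, 12 := []) = load L N s"
    using s by (simp add: s1_def load_def fun_eq_iff enc_0)
  with runs_reset[of s1] len have 5: "runs reset s1 (3 * L + 1) (load L N s)" by simp
  have top: "holds (Top 12) s1 \<longleftrightarrow> complexity N < complexity M"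
    using hd_rev_enc[OF L(1) zb] L(1) sgn by (simp add: s1_def)
  have 6: "runs (if holds (Top 12) s1
        then reset ;; Push 5 (\<not> neg) ;; Push 5 (g = GenB) ;; Push 15 True
        else reset ;; column_op K g (\<not> neg)) s1
      (3 * L + 1 + (K * (36 * L + 10) + 4))
      (if complexity N < complexity M
       then (load L N s)(5 := (g = GenB) # (\<not> neg) # s 5, 15 := True # s 15)
       else load L M s)"
  proof (cases "complexity N < complexity M")
    case True
    have "runs (Push 5 (\<not> neg) ;; Push 5 (g = GenB) ;; Push 15 True) (load L N s)
        (K * (36 * L + 10) + 4)
        ((load L N s)(5 := (g = GenB) # (\<not> neg) # s 5, 15 := True # s 15))"
      by (rule runs_loop_freeI) (simp_all add: load_def fun_eq_iff)
    from runs_Seq[OF 5 this] True top show ?thesis by simp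
  next
    case False
    have "N ** gen_mat g (signed (\<not> neg) (int K)) = M"
      by (simp add: N_def gen_mat_mult signed_def flip: matrix_mul_assoc)
    with runs_column_op[of s K g "\<not> neg" L N] s
    have "runs (column_op K g (\<not> neg)) (load L N s) (K * (36 * L + 10) + 4) (load L M s)"
      by (auto elim: runs_mono)
    from runs_Seq[OF 5 this] show ?thesis
      unfolding top by (simp only: False if_False)
  qed
  from runs_Seq[OF 1 runs_Seq[OF 2 runs_Seq[OF 3 runs_Seq[OF 4 runs_Cond[OF 6]]]]]
  show ?thesis
    unfolding trial_def by (rule runs_mono) (simp add: algebra_simps)
qed

text \<open>The product of the first two components, the current matrix and the word split off so far,
  always is the input matrix; the third component is the counter.\<close>

definition config :: "nat \<Rightarrow> store \<Rightarrow> (int^2^2) \<times> letter list \<times> nat \<Rightarrow> store" where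
  "config L s = (\<lambda>(M, w, n). (load L M s)(5 := word_bits w, 15 := replicate n True))"

definition decreases :: "nat \<Rightarrow> letter \<Rightarrow> int^2^2 \<Rightarrow> bool" where
  "decreases K = (\<lambda>(g, neg) M. complexity (M ** gen_mat g (signed neg (int K))) < complexity M)"

text \<open>The effect of \<open>trial\<close> without stores, on which the invariants are
  proved.\<close>

fun trial_step :: "nat \<Rightarrow> letter \<Rightarrow> (int^2^2) \<times> letter list \<times> nat \<Rightarrow> (int^2^2) \<times> letter list \<times> nat"
  where "trial_step K (g, neg) (M, w, n) =
    (if decreases K (g, neg) M
     then (M ** gen_mat g (signed neg (int K)), (g, \<not> neg) # w, Suc n) else (M, w, n))"

lemma runs_trial_step:
  assumes "s 10 = enc L 0" "s 11 = []" "s 12 = []" "s 13 = []"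
    and "L > 0" "(1 + int K) * int (complexity M) < 2 ^ (L - 1)"
  shows "runs (trial K g neg) (config L s (M, w, n)) ((72 * K + 120) * (L + 1))
    (config L s (trial_step K (g, neg) (M, w, n)))"
proof -
  define s1 where "s1 = s(5 := word_bits w, 15 := replicate n True)"
  have "s1 10 = enc L 0" "s1 11 = []" "s1 12 = []" "s1 13 = []"
    using assms(1-4) by (simp_all add: s1_def)
  note R = runs_trial[OF this assms(5-), of g neg]
  have A: "load L M s1 = config L s (M, w, n)" for M
    by (simp add: config_def load_def s1_def fun_eq_iff)
  have B: "(load L N s1)(5 := (g = GenB) # (\<not> neg) # s1 5, 15 := True # s1 15) =
      config L s (N, (g, \<not> neg) # w, Suc n)" for N
    by (simp add: config_def load_def s1_def fun_eq_iff word_bits_def)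
  show ?thesis
    using R unfolding B unfolding A by (simp add: decreases_def split: if_splits)
qed

text \<open>Each accepted trial trades at least one unit of complexity for one unit of the counter.
  An unchanged counter means that nothing was accepted, so all letters of the list were tried on the
  same matrix.\<close>

lemma fold_trial_step:
  assumes "fold (trial_step K) ls (M, w, n) = (M', w', n')"
  shows "M' ** word_val (int K) w' = M ** word_val (int K) w"
    and "n' + complexity M' \<le> n + complexity M" "complexity M' \<le> complexity M" "n \<le> n'"
    and "n' = n \<Longrightarrow> M' = M \<and> (\<forall>l\<in>set ls. \<not> decreases K l M)"
proof -
  have "M' ** word_val (int K) w' = M ** word_val (int K) w \<and>
    n' + complexity M' \<le> n + complexity M \<and> complexity M' \<le> complexity M \<and> n \<le> n' \<and>
    (n' = n \<longrightarrow> M' = M \<and> (\<forall>l\<in>set ls. \<not> decreases K l M))"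
    using assms
  proof (induction ls arbitrary: M w n)
    case (Cons l ls)
    obtain g neg where l: "l = (g, neg)" by (cases l)
    show ?case
    proof (cases "decreases K l M")
      case True
      define N where "N = M ** gen_mat g (signed neg (int K))"
      have "letter_val (int K) (g, \<not> neg) = gen_mat g (- signed neg (int K))"
        unfolding letter_val_eq by (simp add: signed_def)
      then have "N ** (letter_val (int K) (g, \<not> neg) ** word_val (int K) w) = M ** word_val (int K) w"
        unfolding matrix_mul_assoc by (simp add: N_def gen_mat_mult flip: matrix_mul_assoc)
      moreover have "complexity N < complexity M"
        using True by (simp add: decreases_def l N_def)
      moreover have "fold (trial_step K) ls (N, (g, \<not> neg) # w, Suc n) = (M', w', n')"
        using Cons.prems True by (simp add: l N_def)
      note Cons.IH[OF this]
      ultimately show ?thesis by auto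
    next
      case False
      then have "fold (trial_step K) ls (M, w, n) = (M', w', n')"
        using Cons.prems by (simp add: l)
      from Cons.IH[OF this] False show ?thesis by simp
    qed
  qed simp
  then show "M' ** word_val (int K) w' = M ** word_val (int K) w"
    "n' + complexity M' \<le> n + complexity M" "complexity M' \<le> complexity M" "n \<le> n'"
    "n' = n \<Longrightarrow> M' = M \<and> (\<forall>l\<in>set ls. \<not> decreases K l M)"
    by blast+
qed

definition trials :: "nat \<Rightarrow> letter list \<Rightarrow> program" where
  "trials K ls = foldr (\<lambda>(g, neg) p. trial K g neg ;; p) ls Skip"

lemma runs_trials:
  assumes "s 10 = enc L 0" "s 11 = []" "s 12 = []" "s 13 = []"
    and "L > 0" "(1 + int K) * int (complexity M) < 2 ^ (L - 1)"
  shows "runs (trials K ls) (config L s (M, w, n)) (length ls * ((72 * K + 120) * (L + 1)) + 1)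
    (config L s (fold (trial_step K) ls (M, w, n)))"
  using assms(6)
proof (induction ls arbitrary: M w n)
  case Nil
  show ?case unfolding trials_def by (rule runs_loop_freeI) simp_all
next
  case (Cons l ls)
  obtain g neg where l: "l = (g, neg)" by (cases l)
  obtain N v m where step: "trial_step K l (M, w, n) = (N, v, m)"
    by (metis prod_cases3)
  \<comment> \<open>This keeps the chosen width sufficient for the remaining trials.\<close>
  have "complexity N \<le> complexity M"
    using fold_trial_step(3)[of K "[l]" M w n N v m] step by simp
  then have "(1 + int K) * int (complexity N) \<le> (1 + int K) * int (complexity M)"
    by (intro mult_left_mono) simp_all
  with Cons.prems have "(1 + int K) * int (complexity N) < 2 ^ (L - 1)" by linarith
  from runs_Seq[OF runs_trial_step[OF assms(1-5) Cons.prems, of g neg w n]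
      Cons.IH[OF this, of v m, folded step[unfolded l]]]
  have "runs (trial K g neg ;; trials K ls) (config L s (M, w, n))
      ((72 * K + 120) * (L + 1) + (length ls * ((72 * K + 120) * (L + 1)) + 1))
      (config L s (fold (trial_step K) (l # ls) (M, w, n)))"
    by (simp only: l fold_simps)
  moreover have "trials K (l # ls) = trial K g neg ;; trials K ls"
    by (simp add: trials_def l)
  ultimately show ?case by (simp add: algebra_simps)
qed

definition reduction_loop :: "nat \<Rightarrow> program" where
  "reduction_loop K = While (Nonempty 15)
     (Pop 15 ;; trials K [(GenA, True), (GenA, False), (GenB, True), (GenB, False)])"

text \<open>Every accepted trial raises the counter by one and lowers the complexity, and every pass of
  the loop lowers the counter by one, so that their sum bounds the number of passes. The counter
  runs empty only at the end of a pass in which all four trials failed.\<close>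

lemma runs_reduction_loop:
  assumes "s 10 = enc L 0" "s 11 = []" "s 12 = []" "s 13 = []"
    and "L > 0" "(1 + int K) * int (complexity M) < 2 ^ (L - 1)"
    and "n = 0 \<Longrightarrow> \<forall>l. \<not> decreases K l M"
  shows "\<exists>M' w'. runs (reduction_loop K) (config L s (M, w, n))
      ((n + complexity M) * (4 * ((72 * K + 120) * (L + 1)) + 3) + 1) (config L s (M', w', 0)) \<and>
    M' ** word_val (int K) w' = M ** word_val (int K) w \<and> complexity M' \<le> complexity M \<and>
    (\<forall>l. \<not> decreases K l M')"
  using assms(6,7)
proof (induction "n + complexity M" arbitrary: M w n rule: less_induct)
  case less
  show ?case
  proof (cases n)
    case 0
    then have "runs (reduction_loop K) (config L s (M, w, n)) 1 (config L s (M, w, 0))"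
      unfolding reduction_loop_def using runs_WhileFalse[of "Nonempty 15"]
      by (simp add: config_def)
    from runs_mono[OF this] 0 less.prems(2) show ?thesis
      by (intro exI[of _ M] exI[of _ w]) simp
  next
    case (Suc m)
    \<comment> \<open>The 3 counts the loop test, the \<open>Pop\<close> and the closing
      \<open>Skip\<close> of \<open>trials\<close>.\<close>
    define T where "T = 4 * ((72 * K + 120) * (L + 1)) + 3"
    let ?ls = "[(GenA, True), (GenA, False), (GenB, True), (GenB, False)]"
    obtain N v i where step: "fold (trial_step K) ?ls (M, w, m) = (N, v, i)"
      by (metis prod_cases3)
    note f = fold_trial_step[OF step]
    have "(1 + int K) * int (complexity N) \<le> (1 + int K) * int (complexity M)"
      using f(3) by (intro mult_left_mono) simp_all
    with less.prems have N: "(1 + int K) * int (complexity N) < 2 ^ (L - 1)" by linarith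
    \<comment> \<open>The counter never falls during the trials, so \<open>i = 0\<close> forces
      \<open>m = 0\<close>: all four letters failed on one and the same matrix.\<close>
    have irr: "\<forall>l. \<not> decreases K l N" if "i = 0"
    proof -
      have "N = M" "\<forall>l\<in>set ?ls. \<not> decreases K l M" using f(4,5) that by auto
      moreover have "l \<in> set ?ls" for l
        by (cases l) (cases "fst l"; cases "snd l"; simp)
      ultimately show ?thesis by blast
    qed
    have "i + complexity N < n + complexity M" using f(2) Suc by simp
    from less.hyps[OF this N, of v] irr
    obtain M' w' where IH: "runs (reduction_loop K) (config L s (N, v, i))
        ((i + complexity N) * T + 1) (config L s (M', w', 0))"
      "M' ** word_val (int K) w' = N ** word_val (int K) v" "complexity M' \<le> complexity N"
      "\<forall>l. \<not> decreases K l M'"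
      unfolding T_def by blast
    have "runs (Pop 15) (config L s (M, w, n)) 1 (config L s (M, w, m))"
      by (rule runs_loop_freeI) (simp_all add: config_def Suc)
    from runs_Seq[OF this runs_trials[OF assms(1-5) less.prems(1), of ?ls w m]]
    have body: "runs (Pop 15 ;; trials K ?ls) (config L s (M, w, n)) (T - 1) (config L s (N, v, i))"
      unfolding step by (rule runs_mono) (simp add: T_def)
    have "holds (Nonempty 15) (config L s (M, w, n))" by (simp add: config_def Suc)
    from runs_WhileTrue[OF this body IH(1)[unfolded reduction_loop_def]]
    have R: "runs (reduction_loop K) (config L s (M, w, n)) (1 + (T - 1) + ((i + complexity N) * T + 1))
        (config L s (M', w', 0))"
      by (simp only: reduction_loop_def)
    have "1 + (T - 1) + ((i + complexity N) * T + 1) = (1 + i + complexity N) * T + 1"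
      by (simp add: T_def)
    also have "\<dots> \<le> (n + complexity M) * T + 1"
      using f(2) Suc by (intro add_right_mono mult_right_mono) simp_all
    finally have "runs (reduction_loop K) (config L s (M, w, n)) ((n + complexity M) * T + 1)
        (config L s (M', w', 0))"
      using R runs_mono by blast
    moreover have "M' ** word_val (int K) w' = M ** word_val (int K) w"
      using IH(2) f(1) by simp
    moreover have "complexity M' \<le> complexity M" using IH(3) f(3) by simp
    ultimately show ?thesis
      using IH(4) unfolding T_def by (intro exI[of _ M'] exI[of _ w'] conjI)
  qed
qed


section \<open>Input and output\<close>

text \<open>Each digit 1 leaves a mark on stack 12, so several stacks can be tested for zero one
  after the other and a single test at the end suffices.\<close>

definition clear_checking :: "nat \<Rightarrow> program" where
  "clear_checking x = While (Nonempty x) (Cond (Top x) (Push 12 True) Skip ;; Pop x)"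

lemma runs_clear_checking:
  assumes "x \<noteq> 12"
  shows "runs (clear_checking x) s (4 * length (s x) + 1)
    (s(x := [], 12 := filter id (rev (s x)) @ s 12))"
  using assms
proof (induction "s x" arbitrary: s)
  case Nil
  then show ?case
    using runs_WhileFalse[of "Nonempty x" s] by (simp add: clear_checking_def fun_upd_idem)
next
  case (Cons b bs)
  note sx = Cons(2)[symmetric]
  define s1 where "s1 = s(x := bs, 12 := filter id [b] @ s 12)"
  have body: "runs (Cond (Top x) (Push 12 True) Skip ;; Pop x) s 3 s1"
    using sx Cons(3) by (intro runs_loop_freeI) (auto simp: s1_def fun_eq_iff)
  have "runs (clear_checking x) s1 (4 * length bs + 1)
      (s1(x := [], 12 := filter id (rev bs) @ s1 12))"
    using Cons(1)[of s1] Cons(3) by (simp add: s1_def)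
  moreover have "holds (Nonempty x) s" using sx by simp
  ultimately have R: "runs (clear_checking x) s (1 + 3 + (4 * length bs + 1))
      (s1(x := [], 12 := filter id (rev bs) @ s1 12))"
    using body unfolding clear_checking_def by (intro runs_WhileTrue)
  have eq: "s1(x := [], 12 := filter id (rev bs) @ s1 12) =
      s(x := [], 12 := filter id (rev (s x)) @ s 12)"
    using Cons(3) by (auto simp: s1_def fun_eq_iff sx)
  show ?case using R unfolding eq by (rule runs_mono) (simp add: sx)
qed

text \<open>All \<open>L\<close> digits vanish exactly if \<open>2 ^ L\<close> divides
  \<open>z\<close>.\<close>

lemma True_in_enc: "\<bar>z\<bar> < 2 ^ L \<Longrightarrow> True \<in> set (enc L z) \<longleftrightarrow> z \<noteq> 0"
proof (induction L arbitrary: z)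
  case (Suc L)
  show ?case
  proof (cases "odd z")
    case False
    then have "z div 2 \<noteq> 0 \<longleftrightarrow> z \<noteq> 0" "\<bar>z div 2\<bar> < 2 ^ L"
      using Suc.prems by (auto elim!: evenE simp: abs_mult)
    then show ?thesis using Suc.IH False by simp
  qed auto
qed simp

text \<open>A diagonal entry is 1 if its lowest digit is 1 and the others are 0. So that digit is
  removed when it is 1 and marked as an error when it is 0; then every remaining digit has to
  vanish.\<close>

definition decide :: program where
  "decide = Cond (Top 6) (Pop 6) (Push 12 True) ;; Cond (Top 9) (Pop 9) (Push 12 True) ;;
     clear_checking 6 ;; clear_checking 7 ;; clear_checking 8 ;; clear_checking 9 ;;
     Cond (Nonempty 12) (Push 4 False) (Push 4 True)"

lemma runs_decide:
  assumes "s 12 = []" "L > 0" "int (complexity M) < 2 ^ (L - 1)"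
  shows "\<exists>s'. runs decide (load L M s) (16 * L + 10) s' \<and> s' 4 = (M = mat 1) # s 4 \<and> s' 5 = s 5"
proof -
  obtain L' where L': "L = Suc L'" using assms(2) by (cases L) auto
  \<comment> \<open>For a diagonal entry, \<open>f\<close> is what remains to be checked and
    \<open>r\<close> the mark left by its lowest digit.\<close>
  define f where "f z = (if odd z then enc L' (z div 2) else enc L z)" for z :: int
  define r where "r z = (if odd z then [] else [True])" for z :: int
  define s1 where "s1 = (load L M s)(6 := f (M$1$1), 12 := r (M$1$1))"
  define s2 where "s2 = s1(9 := f (M$2$2), 12 := r (M$2$2) @ r (M$1$1))"
  define chk where "chk x t = t(x := [], 12 := filter id (rev (t x)) @ t 12)" for x and t :: store
  have 1: "runs (Cond (Top 6) (Pop 6) (Push 12 True)) (load L M s) 2 s1"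
    using assms(1)
    by (intro runs_loop_freeI) (auto simp: s1_def load_def f_def r_def L' fun_eq_iff)
  have 2: "runs (Cond (Top 9) (Pop 9) (Push 12 True)) s1 2 s2"
    by (intro runs_loop_freeI) (auto simp: s1_def s2_def load_def f_def r_def L' fun_eq_iff)
  have chk: "runs (clear_checking x) t (4 * L + 1) (chk x t)" if "length (t x) \<le> L" "x \<noteq> 12" for x t
    using runs_clear_checking[OF that(2), of t] runs_mono that(1) unfolding chk_def by fastforce
  have len: "length (f z) \<le> L" for z by (simp add: f_def L')
  have 3: "runs (clear_checking 6) s2 (4 * L + 1) (chk 6 s2)"
    by (rule chk) (simp_all add: s2_def s1_def len)
  have 4: "runs (clear_checking 7) (chk 6 s2) (4 * L + 1) (chk 7 (chk 6 s2))"
    by (rule chk) (simp_all add: s2_def s1_def chk_def load_def)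
  have 5: "runs (clear_checking 8) (chk 7 (chk 6 s2)) (4 * L + 1) (chk 8 (chk 7 (chk 6 s2)))"
    by (rule chk) (simp_all add: s2_def s1_def chk_def load_def)
  define s3 where "s3 = chk 9 (chk 8 (chk 7 (chk 6 s2)))"
  have 6: "runs (clear_checking 9) (chk 8 (chk 7 (chk 6 s2))) (4 * L + 1) s3"
    unfolding s3_def by (rule chk) (simp_all add: s2_def s1_def chk_def load_def len)
  define s4 where "s4 = s3(4 := (s3 12 = []) # s3 4)"
  have 7: "runs (Cond (Nonempty 12) (Push 4 False) (Push 4 True)) s3 2 s4"
    by (intro runs_loop_freeI) (auto simp: s4_def)
  have "runs decide (load L M s) (16 * L + 10) s4"
    using runs_Seq[OF 1 runs_Seq[OF 2 runs_Seq[OF 3 runs_Seq[OF 4 runs_Seq[OF 5 runs_Seq[OF 6 7]]]]]]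
    unfolding decide_def by (rule runs_mono) simp
  moreover have "s3 12 = [] \<longleftrightarrow> M = mat 1"
  proof -
    have small: "\<bar>M$1$1\<bar> < 2 ^ L'" "\<bar>M$1$2\<bar> < 2 ^ L'" "\<bar>M$2$1\<bar> < 2 ^ L'" "\<bar>M$2$2\<bar> < 2 ^ L'"
      using assms(3) unfolding complexity_eq L' by simp_all
    have off: "filter id (rev (enc L z)) = [] \<longleftrightarrow> z = 0" if "\<bar>z\<bar> < 2 ^ L'" for z
      using True_in_enc[of z L] that by (auto simp: filter_empty_conv L')
    have diag: "filter id (rev (f z)) = [] \<and> r z = [] \<longleftrightarrow> z = 1" if "\<bar>z\<bar> < 2 ^ L'" for z
    proof (cases "odd z")
      case True
      then have "\<bar>z div 2\<bar> < 2 ^ L'" "z div 2 = 0 \<longleftrightarrow> z = 1" using that by presburger+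
      with True_in_enc[of "z div 2" L'] True show ?thesis
        by (auto simp: f_def r_def filter_empty_conv)
    qed (auto simp: r_def)
    have "s3 12 = filter id (rev (f (M$2$2))) @ filter id (rev (enc L (M$2$1))) @
        filter id (rev (enc L (M$1$2))) @ filter id (rev (f (M$1$1))) @ r (M$2$2) @ r (M$1$1)"
      by (simp add: s3_def chk_def s2_def s1_def load_def)
    then have "s3 12 = [] \<longleftrightarrow> M$1$1 = 1 \<and> M$1$2 = 0 \<and> M$2$1 = 0 \<and> M$2$2 = 1"
      using off small diag by auto
    then show ?thesis by (simp add: mat2_eq_iff)
  qed
  moreover have "s3 4 = s 4" "s3 5 = s 5"
    by (simp_all add: s3_def chk_def s2_def s1_def load_def)
  ultimately show ?thesis by (intro exI[of _ s4]) (simp add: s4_def)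
qed

definition push_zeros :: program where
  "push_zeros = Push 6 False ;; Push 7 False ;; Push 8 False ;; Push 9 False ;; Push 10 False"

definition zeros :: "nat \<Rightarrow> store \<Rightarrow> store" where
  "zeros m s = s(6 := replicate m False, 7 := replicate m False, 8 := replicate m False,
     9 := replicate m False, 10 := replicate m False)"

text \<open>Every input digit that passes lengthens all five working registers by a zero. The width
  thus arises without counting or comparing lengths.\<close>

definition widen :: "nat \<Rightarrow> program" where
  "widen x = While (Nonempty x) (cond_bit x (\<lambda>b. Pop x ;; Push 12 b) ;; push_zeros) ;; move 12 x"

lemma runs_widen:
  assumes "s 12 = []" "x < 6"
  shows "runs (widen x) (zeros m s) (13 * length (s x) + 2) (zeros (m + length (s x)) s)"
proof -
  have loop: "runs (While (Nonempty x) (cond_bit x (\<lambda>b. Pop x ;; Push 12 b) ;; push_zeros))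
      (zeros m s) (9 * length (s x) + 1)
      (zeros (m + length (s x)) (s(x := [], 12 := rev (s x) @ s 12)))" for s
  proof (induction "s x" arbitrary: m s)
    case Nil
    have eq: "s(x := [], 12 := rev (s x) @ s 12) = s" "m + length (s x) = m" "9 * length (s x) + 1 = 1"
      using Nil by (simp_all add: fun_eq_iff)
    have "\<not> holds (Nonempty x) (zeros m s)" using Nil assms(2) by (simp add: zeros_def)
    then show ?case unfolding eq by (rule runs_WhileFalse)
  next
    case (Cons b bs)
    note sx = Cons(2)[symmetric]
    define s1 where "s1 = s(x := bs, 12 := b # s 12)"
    have body: "runs (cond_bit x (\<lambda>b. Pop x ;; Push 12 b) ;; push_zeros) (zeros m s) 8
        (zeros (Suc m) s1)"
      using sx assms(2)
      by (intro runs_loop_freeI) (auto simp: cond_bit_def push_zeros_def zeros_def s1_def fun_eq_iff)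
    have top: "holds (Nonempty x) (zeros m s)" using sx assms(2) by (simp add: zeros_def)
    have "s1 x = bs" using assms(2) by (simp add: s1_def)
    with Cons(1)[of s1 "Suc m"]
    have "runs (While (Nonempty x) (cond_bit x (\<lambda>b. Pop x ;; Push 12 b) ;; push_zeros))
        (zeros (Suc m) s1) (9 * length bs + 1)
        (zeros (Suc m + length bs) (s1(x := [], 12 := rev bs @ s1 12)))" by simp
    note R = runs_WhileTrue[OF top body this]
    have "s1(x := [], 12 := rev bs @ s1 12) = s(x := [], 12 := rev (s x) @ s 12)"
      using assms(2) by (auto simp: s1_def sx fun_eq_iff)
    moreover have "Suc m + length bs = m + length (s x)" by (simp add: sx)
    ultimately show ?case using R by (auto simp: sx elim: runs_mono)
  qed
  define t where "t = zeros (m + length (s x)) (s(x := [], 12 := rev (s x) @ s 12))"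
  have "t(12 := [], x := rev (t 12) @ t x) = zeros (m + length (s x)) s"
    using assms by (auto simp: t_def zeros_def fun_eq_iff)
  moreover have "length (t 12) = length (s x)" using assms by (simp add: t_def zeros_def)
  ultimately have "runs (move 12 x) t (4 * length (s x) + 1) (zeros (m + length (s x)) s)"
    using runs_move[of 12 x t] assms(2) by simp
  from runs_Seq[OF loop[of s] this[unfolded t_def]] show ?thesis
    unfolding widen_def by (rule runs_mono) simp
qed

text \<open>Adding the magnitude to a zero register, or subtracting it, turns sign and magnitude
  into two's complement.\<close>

definition read_entry :: "nat \<Rightarrow> program" where
  "read_entry x = Cond (Top x) (Pop x ;; add True (6 + x) x) (Pop x ;; add False (6 + x) x)"

lemma runs_read_entry:
  assumes "s x = int_digits z" "s (6 + x) = enc L 0" "length (nat_digits (nat \<bar>z\<bar>)) \<le> L"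
    and "s 11 = []" "s 12 = []" "s 13 = []" "x < 5"
  shows "runs (read_entry x) s (18 * L + 7) (s(6 + x := enc L z, x := enc L \<bar>z\<bar>))"
proof -
  define s1 where "s1 = s(x := nat_digits (nat \<bar>z\<bar>))"
  have pop: "runs (Pop x) s 1 s1"
    using assms(1) by (intro runs_loop_freeI) (simp_all add: s1_def int_digits_def)
  have "runs (add (z < 0) (6 + x) x) s1 (18 * L + 5)
      (s1(6 + x := enc L (0 + signed (z < 0) \<bar>z\<bar>), x := enc L \<bar>z\<bar>))"
    by (rule runs_add_ext) (use assms in \<open>simp_all add: s1_def ext_nat_digits\<close>)
  moreover have "0 + signed (z < 0) \<bar>z\<bar> = z" by (simp add: signed_def)
  moreover have "s1(6 + x := enc L z, x := enc L \<bar>z\<bar>) = s(6 + x := enc L z, x := enc L \<bar>z\<bar>)"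
    by (simp add: s1_def fun_eq_iff)
  ultimately have "runs (add (z < 0) (6 + x) x) s1 (18 * L + 5)
      (s(6 + x := enc L z, x := enc L \<bar>z\<bar>))" by simp
  from runs_Seq[OF pop this]
  have "runs (if holds (Top x) s then Pop x ;; add True (6 + x) x else Pop x ;; add False (6 + x) x) s
      (18 * L + 6) (s(6 + x := enc L z, x := enc L \<bar>z\<bar>))"
    using assms(1) by (cases "z < 0") (simp_all add: int_digits_def add.commute)
  from runs_Cond[OF this] show ?thesis by (simp add: read_entry_def add.commute)
qed

definition read_input :: "nat \<Rightarrow> program" where
  "read_input K = widen 0 ;; widen 1 ;; widen 2 ;; widen 3 ;; repeat K push_zeros ;;
     read_entry 0 ;; read_entry 1 ;; read_entry 2 ;; read_entry 3 ;; Push 15 True"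

text \<open>A sum of lengths rather than a maximum, as produced by \<open>widen\<close>; the summand
  \<open>K\<close> is headroom for the factor \<open>1 + K\<close>.\<close>

definition width :: "nat \<Rightarrow> int^2^2 \<Rightarrow> nat" where
  "width K M = length (int_digits (M$1$1)) + length (int_digits (M$1$2)) +
     length (int_digits (M$2$1)) + length (int_digits (M$2$2)) + K"

lemma runs_read_input:
  "\<exists>s. runs (read_input K) (input_store M) (130 * width K M + 40)
      (config (width K M) s (M, [], 1)) \<and> s 10 = enc (width K M) 0 \<and> s 4 = [] \<and>
      s 11 = [] \<and> s 12 = [] \<and> s 13 = []"
proof -
  define L where "L = width K M"
  define s0 where "s0 = input_store M"
  define l0 l1 l2 l3 where "l0 = length (s0 0)" "l1 = length (s0 1)" "l2 = length (s0 2)"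
    "l3 = length (s0 3)"
  note l = this
  have in0: "s0 0 = int_digits (M$1$1)" "s0 1 = int_digits (M$1$2)" "s0 2 = int_digits (M$2$1)"
    "s0 3 = int_digits (M$2$2)" "s0 12 = []" "\<And>x. x > 3 \<Longrightarrow> s0 x = []"
    by (simp_all add: s0_def input_store_def)
  have L: "L = 0 + l0 + l1 + l2 + l3 + K"
    by (simp add: L_def width_def l in0 del: One_nat_def)
  have w: "runs (widen x) (zeros m s0) (13 * L + 2) (zeros (m + length (s0 x)) s0)" if "x < 4" for x m
  proof (rule runs_mono[OF runs_widen])
    have "x = 0 \<or> x = 1 \<or> x = 2 \<or> x = 3" using that by linarith
    then have "length (s0 x) \<le> L" using L l by auto
    then show "13 * length (s0 x) + 2 \<le> 13 * L + 2" by simp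
  qed (use in0 that in auto)
  have z0: "zeros 0 s0 = s0" using in0(6) by (simp add: zeros_def fun_eq_iff)
  have "runs push_zeros (zeros m s0) 5 (zeros (Suc m) s0)" for m
    by (rule runs_loop_freeI) (simp_all add: push_zeros_def zeros_def fun_eq_iff)
  then have pad: "runs (repeat K push_zeros) (zeros (0 + l0 + l1 + l2 + l3) s0) (5 * L + 1) (zeros L s0)"
    using runs_repeat[of K push_zeros "\<lambda>i. zeros (0 + l0 + l1 + l2 + l3 + i) s0" 5] L
    by (auto elim: runs_mono)
  define t0 where "t0 = zeros L s0"
  define t1 where "t1 = t0(6 := enc L (M$1$1), 0 := enc L \<bar>M$1$1\<bar>)"
  define t2 where "t2 = t1(7 := enc L (M$1$2), 1 := enc L \<bar>M$1$2\<bar>)"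
  define t3 where "t3 = t2(8 := enc L (M$2$1), 2 := enc L \<bar>M$2$1\<bar>)"
  define t4 where "t4 = t3(9 := enc L (M$2$2), 3 := enc L \<bar>M$2$2\<bar>)"
  have t0: "t0 x = enc L 0" if "x \<in> {6,7,8,9,10}" for x
    using that by (auto simp: t0_def zeros_def enc_0)
  have t0': "t0 x = s0 x" if "x \<notin> {6,7,8,9,10}" for x
    using that by (auto simp: t0_def zeros_def)
  have len: "length (nat_digits (nat \<bar>M$i$j\<bar>)) \<le> L" for i j
    using exhaust_2[of i] exhaust_2[of j] by (auto simp: L_def width_def int_digits_def)
  have r0: "runs (read_entry 0) t0 (18 * L + 7) t1"
    using runs_read_entry[of t0 0 "M$1$1" L] len by (simp add: t1_def t0 t0' in0)
  have r1: "runs (read_entry 1) t1 (18 * L + 7) t2"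
    using runs_read_entry[of t1 1 "M$1$2" L] len by (simp add: t1_def t2_def t0 t0' in0 del: One_nat_def)
  have r2: "runs (read_entry 2) t2 (18 * L + 7) t3"
    using runs_read_entry[of t2 2 "M$2$1" L] len by (simp add: t1_def t2_def t3_def t0 t0' in0)
  have r3: "runs (read_entry 3) t3 (18 * L + 7) t4"
    using runs_read_entry[of t3 3 "M$2$2" L] len
    by (simp add: t1_def t2_def t3_def t4_def t0 t0' in0)
  have t4: "t4 = load L M t4"
    by (simp add: t4_def t3_def t2_def t1_def load_def fun_eq_iff)
  have final: "runs (Push 15 True) t4 1 (config L t4 (M, [], 1))"
    by (rule runs_loop_freeI)
      (simp_all add: t4_def t3_def t2_def t1_def load_def config_def word_bits_def fun_eq_iff t0' in0)
  have "runs (read_input K) s0 (130 * L + 40) (config L t4 (M, [], 1))"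
    unfolding read_input_def
  proof (rule runs_mono)
    show "runs (widen 0 ;; widen 1 ;; widen 2 ;; widen 3 ;; repeat K push_zeros ;;
        read_entry 0 ;; read_entry 1 ;; read_entry 2 ;; read_entry 3 ;; Push 15 True) s0
      ((13 * L + 2) + ((13 * L + 2) + ((13 * L + 2) + ((13 * L + 2) + ((5 * L + 1) +
       ((18 * L + 7) + ((18 * L + 7) + ((18 * L + 7) + ((18 * L + 7) + 1)))))))))
      (config L t4 (M, [], 1))"
      using w[of 0 0, folded l, unfolded z0] w[of 1 "0 + l0", folded l]
        w[of 2 "0 + l0 + l1", folded l] w[of 3 "0 + l0 + l1 + l2", folded l]
        pad[folded t0_def] r0 r1 r2 r3 final
      by (intro runs_Seq) simp_all
  qed simp
  then show ?thesis
    unfolding L_def[symmetric] s0_def[symmetric]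
    by (intro exI[of _ t4]) (simp add: t4_def t3_def t2_def t1_def t0 t0' in0)
qed

section \<open>Digit counts and the size of the width\<close>

lemma length_nat_digits_le_iff: "length (nat_digits n) \<le> L \<longleftrightarrow> n < 2 ^ L"
proof (induction L arbitrary: n)
  case 0
  show ?case by (simp add: nat_digits.simps[of n])
next
  case (Suc L)
  show ?case
  proof (cases "n = 0")
    case True
    then show ?thesis by (simp add: nat_digits.simps[of 0])
  next
    case False
    then have "length (nat_digits n) \<le> Suc L \<longleftrightarrow> length (nat_digits (n div 2)) \<le> L"
      by (simp add: nat_digits.simps[of n])
    also have "\<dots> \<longleftrightarrow> n < 2 ^ Suc L"
      unfolding Suc.IH by auto
    finally show ?thesis .
  qed
qed

text \<open>A number with \<open>l + 1\<close> digits is at least \<open>2 ^ l\<close>.\<close>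

lemma length_nat_digits_le_log:
  assumes "n > 0"
  shows "real (length (nat_digits n)) \<le> log 2 (real n) + 1"
proof (cases "length (nat_digits n)")
  case 0
  then show ?thesis using assms by simp
next
  case (Suc l)
  then have "2 ^ l \<le> n" using length_nat_digits_le_iff[of n l] by simp
  then have "real l \<le> log 2 (real n)" by (rule le_log2_of_power)
  then show ?thesis using Suc by simp
qed

lemma abs_entry_le_complexity: "nat \<bar>M $ i $ j\<bar> \<le> complexity M"
  using exhaust_2[of i] exhaust_2[of j] complexity_eq[of M] by auto

lemma width_le: "width K M \<le> 4 * (1 + length (nat_digits (complexity M))) + K"
proof -
  have "length (int_digits (M $ i $ j)) \<le> 1 + length (nat_digits (complexity M))" for i j
  proof -
    have "complexity M < 2 ^ length (nat_digits (complexity M))"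
      using length_nat_digits_le_iff by blast
    with abs_entry_le_complexity[of M i j]
    have "length (nat_digits (nat \<bar>M $ i $ j\<bar>)) \<le> length (nat_digits (complexity M))"
      unfolding length_nat_digits_le_iff by (rule le_less_trans)
    then show ?thesis by (simp add: int_digits_def)
  qed
  from this[of 1 1] this[of 1 2] this[of 2 1] this[of 2 2] show ?thesis
    unfolding width_def by simp
qed

text \<open>The four entries contribute a factor 4, and \<open>1 + K\<close> is at most
  \<open>2 ^ K\<close>, so \<open>t + 2 + K\<close> digits hold the product. The four sign digits
  counted in the width provide the 2 and the place for the sign.\<close>

lemma complexity_lt_width:
  "width K M > 0" "(1 + int K) * int (complexity M) < 2 ^ (width K M - 1)"
proof -
  define l where "l i j = length (nat_digits (nat \<bar>M $ i $ j\<bar>))" for i j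
  define t where "t = l 1 1 + l 1 2 + l 2 1 + l 2 2"
  have width: "width K M = t + 4 + K"
    by (simp add: width_def int_digits_def t_def l_def)
  then show "width K M > 0" by simp
  have small: "\<bar>M $ i $ j\<bar> < 2 ^ t" if "l i j \<le> t" for i j
    using length_nat_digits_le_iff[of "nat \<bar>M $ i $ j\<bar>" t] that unfolding l_def
    by (simp add: nat_less_iff)
  have "int (complexity M) < 4 * 2 ^ t"
    using small[of 1 1] small[of 1 2] small[of 2 1] small[of 2 2]
    unfolding complexity_eq t_def by simp
  moreover have "1 + int K \<le> 2 ^ K"
    by (induction K) simp_all
  ultimately have "(1 + int K) * int (complexity M) < 2 ^ K * (4 * 2 ^ t)"
    by (intro mult_le_less_imp_less) simp_all
  also have "\<dots> = 2 ^ (t + 2 + K)" by (simp add: power_add)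
  also have "\<dots> \<le> (2 :: int) ^ (width K M - 1)"
    unfolding width by (intro power_increasing) simp_all
  finally show "(1 + int K) * int (complexity M) < 2 ^ (width K M - 1)" .
qed

section \<open>Correctness and total running time\<close>

text \<open>The split-off word lies in the subgroup, so \<open>M\<close> and the remaining matrix
  \<open>N\<close> lie in the same coset. Hence membership of \<open>M\<close> can be read off from
  \<open>N\<close>.\<close>

lemma generate_cofactor_iff:
  assumes "M \<in> carrier SL2Z" "N ** word_val k w = M"
  shows "N \<in> generate SL2Z {matA k, matB k} \<longleftrightarrow> M \<in> generate SL2Z {matA k, matB k}"
proof -
  interpret group SL2Z by (rule group_SL2Z)
  have sub: "subgroup (generate SL2Z {matA k, matB k}) SL2Z"
    by (rule generate_is_subgroup) (simp add: matA_in_SL2Z matB_in_SL2Z)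
  have W: "word_val k w \<in> generate SL2Z {matA k, matB k}" "word_val k w \<in> carrier SL2Z"
    using word_val_in_generate subgroup.mem_carrier[OF sub] by blast+
  have "det N = 1"
    using assms W(2) det_mul[of N "word_val k w"] by (simp add: SL2Z_def)
  then have "N \<in> carrier SL2Z" by (simp add: SL2Z_def)
  then have "N = M \<otimes>\<^bsub>SL2Z\<^esub> inv\<^bsub>SL2Z\<^esub> word_val k w"
    using inv_solve_right[of N M "word_val k w"] assms W(2) by simp
  then show ?thesis
    using subgroup.m_closed[OF sub] subgroup.m_inv_closed[OF sub] W(1) assms(2) SL2Z_mult by metis
qed

definition membership :: "nat \<Rightarrow> program" where
  "membership K = read_input K ;; reduction_loop K ;; decide"

text \<open>The width depends on all entries and is replaced by its bound from
  \<open>width_le\<close>, a function of \<open>n\<close> alone. There are at most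
  \<open>n + 1\<close> passes; one further unit of the first factor absorbs input and final
  test.\<close>

definition membership_time :: "nat \<Rightarrow> nat \<Rightarrow> nat" where
  "membership_time K n =
     (n + 2) * ((4 * (72 * K + 120) + 153) * (4 * (1 + length (nat_digits n)) + K + 1))"

lemma runs_membership:
  assumes "M \<in> carrier SL2Z" "K \<ge> 2"
  shows "\<exists>s w. runs (membership K) (input_store M) (membership_time K (complexity M)) s \<and>
    s 4 = [M \<in> generate SL2Z {matA (int K), matB (int K)}] \<and> s 5 = word_bits w \<and>
    (M \<in> generate SL2Z {matA (int K), matB (int K)} \<longrightarrow> word_val (int K) w = M)"
proof -
  define L where "L = width K M"
  note L = complexity_lt_width[where K = K and M = M, folded L_def]
  obtain s where read: "runs (read_input K) (input_store M) (130 * L + 40) (config L s (M, [], 1))"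
    and s: "s 10 = enc L 0" "s 4 = []" "s 11 = []" "s 12 = []" "s 13 = []"
    using runs_read_input[of K M] unfolding L_def by blast
  \<comment> \<open>The counter starts at 1, so at least one pass is made and the condition on an
    empty counter holds vacuously.\<close>
  obtain N w where loop: "runs (reduction_loop K) (config L s (M, [], 1))
      ((1 + complexity M) * (4 * ((72 * K + 120) * (L + 1)) + 3) + 1) (config L s (N, w, 0))"
    and N: "N ** word_val (int K) w = M" "complexity N \<le> complexity M" "\<forall>l. \<not> decreases K l N"
    using runs_reduction_loop[of s L K M 1 "[]"] s L by (auto simp: matrix_mul_rid)
  have "int (complexity N) \<le> (1 + int K) * int (complexity M)"
    using N(2) by (simp add: distrib_right add_increasing2)
  with L(2) have "int (complexity N) < 2 ^ (L - 1)" by linarith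
  moreover have "config L s (N, w, 0) = load L N (s(5 := word_bits w, 15 := []))"
    by (simp add: config_def load_def fun_eq_iff)
  ultimately obtain s' where dec: "runs decide (config L s (N, w, 0)) (16 * L + 10) s'"
    and s': "s' 4 = [N = mat 1]" "s' 5 = word_bits w"
    using runs_decide[of "s(5 := word_bits w, 15 := [])" L N] s L(1) by auto
  have "runs (membership K) (input_store M) (membership_time K (complexity M)) s'"
    unfolding membership_def
  proof (rule runs_mono[OF runs_Seq[OF read runs_Seq[OF loop dec]]])
    define n W where "n = complexity M" and "W = 4 * (1 + length (nat_digits n)) + K"
    define X where "X = 72 * K + 120"
    have "L \<le> W" using width_le[of K M] by (simp add: L_def W_def n_def)
    then have "(1 + n) * (4 * (X * (L + 1)) + 3) \<le> (1 + n) * (4 * (X * (W + 1)) + 3)"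
      by (intro mult_left_mono add_right_mono) simp_all
    moreover have "130 * L + 40 + 1 + (16 * L + 10) \<le> 150 * (W + 1)"
      using \<open>L \<le> W\<close> by simp
    moreover have "(1 + n) * (4 * (X * (W + 1)) + 3) + 150 * (W + 1) \<le>
        (n + 2) * ((4 * X + 153) * (W + 1))"
      by (simp add: algebra_simps)
    ultimately show "130 * L + 40 + ((1 + complexity M) * (4 * ((72 * K + 120) * (L + 1)) + 3) + 1 +
        (16 * L + 10)) \<le> membership_time K (complexity M)"
      unfolding membership_time_def n_def[symmetric] W_def[symmetric] X_def[symmetric] by linarith
  qed
  moreover have iff: "N = mat 1 \<longleftrightarrow> M \<in> generate SL2Z {matA (int K), matB (int K)}"
  proof
    assume "N = mat 1"
    then show "M \<in> generate SL2Z {matA (int K), matB (int K)}"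
      using N(1) word_val_in_generate[of "int K" w] by simp
  next
    assume "M \<in> generate SL2Z {matA (int K), matB (int K)}"
    then have "N \<in> generate SL2Z {matA (int K), matB (int K)}"
      using generate_cofactor_iff[OF assms(1) N(1)] by simp
    then show "N = mat 1"
      using generate_irreducible[of N "int K"] assms(2) N(3)
      by (auto simp: decreases_def signed_def)
  qed
  ultimately show ?thesis
    using s' N(1) by (intro exI[of _ s'] exI[of _ w]) auto
qed

lemma membership_time_bigo:
  "(\<lambda>n. real (membership_time K n)) \<in> O(\<lambda>n. real n * ln (real n))"
proof -
  define C where "C = real (4 * (72 * K + 120) + 153)"
  define g where "g n = (real n + 2) * (C * (4 * log 2 (real n) + (9 + real K)))" for n
  have "real (membership_time K n) \<le> g n" if "n > 0" for n
  proof -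
    \<comment> \<open>The digit bound \<open>log 2 n + 1\<close> enters four times, so the constants
      add up to \<open>4 + 4 + K + 1\<close>.\<close>
    have "real (4 * (1 + length (nat_digits n)) + K + 1) \<le> 4 * log 2 (real n) + (9 + real K)"
      using length_nat_digits_le_log[OF that] by simp
    then show ?thesis
      unfolding membership_time_def g_def C_def of_nat_mult
      by (intro mult_mono) simp_all
  qed
  then have "eventually (\<lambda>n. norm (real (membership_time K n)) \<le> g n) at_top"
    by (auto intro: eventually_mono[OF eventually_gt_at_top[of 0]])
  then have "(\<lambda>n. real (membership_time K n)) \<in> O(g)"
    by (intro landau_o.big_mono) (auto elim!: eventually_mono)
  also have "g \<in> O(\<lambda>n. real n * ln (real n))"
  proof -
    have "(\<lambda>n. 4 * log 2 (real n)) \<in> O(\<lambda>n. ln (real n))" by real_asymp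
    moreover have "(\<lambda>n. 9 + real K) \<in> O(\<lambda>n. ln (real n))" by real_asymp
    ultimately have "(\<lambda>n. 4 * log 2 (real n) + (9 + real K)) \<in> O(\<lambda>n. ln (real n))"
      by (rule sum_in_bigo(1))
    then have "(\<lambda>n. C * (4 * log 2 (real n) + (9 + real K))) \<in> O(\<lambda>n. ln (real n))"
      by (subst landau_o.big.cmult_in_iff) (auto simp: C_def)
    moreover have "(\<lambda>n. real n + 2) \<in> O(\<lambda>n. real n)" by real_asymp
    ultimately show ?thesis
      unfolding g_def by (intro landau_o.big.mult)
  qed
  finally show ?thesis .
qed

theorem corollary3:
  fixes k :: int
  assumes "k \<ge> 2"
  shows "\<exists>(p :: program) (T :: nat \<Rightarrow> nat).
    (\<lambda>n. real (T n)) \<in> O(\<lambda>n. real n * ln (real n)) \<and>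
    (\<forall>M \<in> carrier SL2Z. \<exists>t s.
       exec p (input_store M) t s \<and>
       t \<le> T (complexity M) \<and>
       answer s = [M \<in> generate SL2Z {matA k, matB k}] \<and>
       (M \<in> generate SL2Z {matA k, matB k} \<longrightarrow>
          (\<exists>w. word_output s = word_bits w \<and> word_val k w = M)))"
proof -
  have "\<exists>t s. exec (membership (nat k)) (input_store M) t s \<and>
      t \<le> membership_time (nat k) (complexity M) \<and>
      answer s = [M \<in> generate SL2Z {matA k, matB k}] \<and>
      (M \<in> generate SL2Z {matA k, matB k} \<longrightarrow>
         (\<exists>w. word_output s = word_bits w \<and> word_val k w = M))"
    if "M \<in> carrier SL2Z" for M
  proof -
    have "nat k \<ge> 2" "int (nat k) = k" using assms by simp_all
    with that obtain s w where "runs (membership (nat k)) (input_store M)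
        (membership_time (nat k) (complexity M)) s"
      "s 4 = [M \<in> generate SL2Z {matA k, matB k}]" "s 5 = word_bits w"
      "M \<in> generate SL2Z {matA k, matB k} \<longrightarrow> word_val k w = M"
      using runs_membership[of M "nat k"] by metis
    then show ?thesis
      unfolding runs_def answer_def word_output_def by blast
  qed
  then show ?thesis using membership_time_bigo[of "nat k"] by blast
qed

end
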